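(* Let $m\ge3$, $n=m-2$, and let $\mathfrak{su}(m)=\mathfrak{h}\oplus\mathfrak{m}$ be the reductive decomposition related to $M=\frac{\mathrm{SU}(m)}{S(\mathrm{U}(m-2)\times\mathrm{U}(1))}$. Then $$\dim_{\mathbb{R}}\mathrm{Hom}_{\mathfrak{h}}(\mathfrak{m}\otimes\mathfrak{m},\mathfrak{m})=99,\qquad\dim_{\mathbb{R}}\mathrm{Hom}_{\mathfrak{h}}(\mathfrak{m},\Lambda^2\mathfrak{m})=45,\qquad\dim_{\mathbb{R}}\mathrm{Hom}_{\mathfrak{h}}(\Lambda^3\mathfrak{m},\mathbb{R})=13.$$
   Context: $\mathfrak{su}(m)=\{A\in\mathcal{M}_m(\mathbb{C}):A+\bar A^t=0,\ \mathrm{tr}A=0\}$. With matrices in blocks $1+n+1$, the reductive decomposition is $$\mathfrak{h}=\left\{\begin{pmatrix}-\frac{\mathrm{tr}B}{2}&0&0\\0&B&0\\0&0&-\frac{\mathrm{tr}B}{2}\end{pmatrix}:B\in\mathfrak{u}(n)\right\},\qquad\mathfrak{m}=\left\{\begin{pmatrix}\alpha\mathbf{i}&z_2^t&w\\-\bar z_2&0&z_1\\-\bar w&-\bar z_1^t&-\alpha\mathbf{i}\end{pmatrix}:z_1,z_2\in\mathbb{C}^n,\ w\in\mathbb{C},\ \alpha\in\mathbb{R}\right\}.$$ $\mathfrak{m}$ is an $\mathfrak{h}$-module by the bracket; $\mathfrak{m}\otimes\mathfrak{m}$, $\Lambda^k\mathfrak{m}$ (over $\mathbb{R}$) have the induced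 actions, $\mathbb{R}$ is the trivial module and $\mathrm{Hom}_{\mathfrak{h}}$ denotes real linear $\mathfrak{h}$-module homomorphisms. *)

theory Defs
  imports "HOL-Analysis.Analysis" "HOL-Analysis.Finite_Function_Topology" "HOL-Library.Function_Algebras"
begin

section \<open>The real vector space of functions into a real vector space\<close>

instantiation "fun" :: (type, real_vector) real_vector
begin

definition scaleR_fun_def: "c *\<^sub>R f = (\<lambda>x. c *\<^sub>R f x)"

instance
  by standard (auto simp: scaleR_fun_def fun_eq_iff algebra_simps)

end

section \<open>Free vector spaces\<close>

text \<open>The free real vector space on a set of generators of type \<open>'k\<close> is \<open>'k \<Rightarrow>\<^sub>0 real\<close>.\<close>

definition free_gen :: "'k \<Rightarrow> ('k \<Rightarrow>\<^sub>0 real)" where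
  "free_gen k = Poly_Mapping.single k 1"

definition free_lift :: "('k \<Rightarrow> 'c::real_vector) \<Rightarrow> ('k \<Rightarrow>\<^sub>0 real) \<Rightarrow> 'c" where
  "free_lift f p = (\<Sum>k\<in>Poly_Mapping.keys p. Poly_Mapping.lookup p k *\<^sub>R f k)"

lemma lookup_scaleR_pm: "Poly_Mapping.lookup (c *\<^sub>R p) k = c *\<^sub>R Poly_Mapping.lookup (p :: 'k \<Rightarrow>\<^sub>0 real) k"
proof -
  have "finite {x. c *\<^sub>R Poly_Mapping.lookup p x \<noteq> 0}"
    by (rule finite_subset[OF _ finite_lookup[of p]]) auto
  then show ?thesis
    by (simp add: scaleR_poly_mapping_def Abs_poly_mapping_inverse)
qed

lemma free_lift_superset:
  assumes "finite S" "Poly_Mapping.keys p \<subseteq> S"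
  shows "free_lift f p = (\<Sum>k\<in>S. Poly_Mapping.lookup p k *\<^sub>R f k)"
  unfolding free_lift_def using assms
  by (intro sum.mono_neutral_left) (auto simp: in_keys_iff)

lemma linear_free_lift: "linear (free_lift f)"
proof (rule linearI)
  fix p q :: "'a \<Rightarrow>\<^sub>0 real"
  let ?S = "Poly_Mapping.keys p \<union> Poly_Mapping.keys q"
  have "free_lift f (p + q) = (\<Sum>k\<in>?S. Poly_Mapping.lookup (p + q) k *\<^sub>R f k)"
    by (rule free_lift_superset) (simp_all add: keys_add)
  also have "\<dots> = free_lift f p + free_lift f q"
    by (simp add: free_lift_superset[of ?S] lookup_add scaleR_add_left sum.distrib)
  finally show "free_lift f (p + q) = free_lift f p + free_lift f q" .
next
  fix c :: real and p :: "'a \<Rightarrow>\<^sub>0 real"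
  have "free_lift f (c *\<^sub>R p) = (\<Sum>k\<in>Poly_Mapping.keys p. Poly_Mapping.lookup (c *\<^sub>R p) k *\<^sub>R f k)"
    by (rule free_lift_superset) (auto simp: in_keys_iff lookup_scaleR_pm)
  also have "\<dots> = c *\<^sub>R free_lift f p"
    by (simp add: free_lift_def lookup_scaleR_pm scaleR_sum_right)
  finally show "free_lift f (c *\<^sub>R p) = c *\<^sub>R free_lift f p" .
qed

lemma free_lift_gen [simp]: "free_lift f (free_gen k) = f k"
  by (simp add: free_lift_def free_gen_def)

lemma free_expand: "p = free_lift free_gen p"
proof (rule poly_mapping_eqI)
  fix k
  have "Poly_Mapping.lookup (free_lift free_gen p) k
      = (\<Sum>j\<in>Poly_Mapping.keys p. Poly_Mapping.lookup (Poly_Mapping.lookup p j *\<^sub>R free_gen j) k)"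
    by (simp add: free_lift_def lookup_sum)
  also have "\<dots> = (\<Sum>j\<in>Poly_Mapping.keys p. if j = k then Poly_Mapping.lookup p k else 0)"
    by (intro sum.cong) (auto simp: lookup_scaleR_pm free_gen_def lookup_single when_def)
  also have "\<dots> = Poly_Mapping.lookup p k"
    by (auto simp: in_keys_iff)
  finally show "Poly_Mapping.lookup p k = Poly_Mapping.lookup (free_lift free_gen p) k" ..
qed

lemma linear_eq_on_free_gen:
  assumes "linear F" "linear G" "\<And>k. F (free_gen k) = G (free_gen k)"
  shows "F p = G p"
proof -
  have "F (free_lift free_gen p) = G (free_lift free_gen p)"
    unfolding free_lift_def
    using assms by (simp add: linear_sum linear_cmul)
  then show ?thesis using free_expand[of p] by simp
qed

lemma span_cong:
  fixes p q r s :: "'v::real_vector"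
  shows span_cong_refl: "p - p \<in> span S"
    and span_cong_sym: "p - q \<in> span S \<Longrightarrow> q - p \<in> span S"
    and span_cong_trans: "p - q \<in> span S \<Longrightarrow> q - r \<in> span S \<Longrightarrow> p - r \<in> span S"
    and span_cong_add: "p - q \<in> span S \<Longrightarrow> r - s \<in> span S \<Longrightarrow> (p + r) - (q + s) \<in> span S"
    and span_cong_diff: "p - q \<in> span S \<Longrightarrow> r - s \<in> span S \<Longrightarrow> (p - r) - (q - s) \<in> span S"
    and span_cong_uminus: "p - q \<in> span S \<Longrightarrow> - p - - q \<in> span S"
    and span_cong_scaleR: "p - q \<in> span S \<Longrightarrow> c *\<^sub>R p - c *\<^sub>R q \<in> span S"
proof -
  show "p - p \<in> span S" by (simp add: span_zero)
  show "q - p \<in> span S" if "p - q \<in> span S" using span_neg[OF that] by simp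
  show "p - r \<in> span S" if "p - q \<in> span S" "q - r \<in> span S" using span_add[OF that] by simp
  show "(p + r) - (q + s) \<in> span S" if "p - q \<in> span S" "r - s \<in> span S"
    using span_add[OF that] by (simp add: algebra_simps)
  show "(p - r) - (q - s) \<in> span S" if "p - q \<in> span S" "r - s \<in> span S"
    using span_diff[OF that] by (simp add: algebra_simps)
  show "- p - - q \<in> span S" if "p - q \<in> span S" using span_neg[OF that] by simp
  show "c *\<^sub>R p - c *\<^sub>R q \<in> span S" if "p - q \<in> span S"
    using span_scale[OF that, of c] by (simp add: scaleR_diff_right)
qed

section \<open>Tensor products\<close>

definition tensor_relators :: "(('a::real_vector \<times> 'b::real_vector) \<Rightarrow>\<^sub>0 real) set" where
  "tensor_relators =
     {free_gen (x + x', y) - free_gen (x, y) - free_gen (x', y) | x x' y. True} \<union>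
     {free_gen (x, y + y') - free_gen (x, y) - free_gen (x, y') | x y y'. True} \<union>
     {free_gen (c *\<^sub>R x, y) - c *\<^sub>R free_gen (x, y) | c x y. True} \<union>
     {free_gen (x, c *\<^sub>R y) - c *\<^sub>R free_gen (x, y) | c x y. True}"

quotient_type (overloaded) ('a, 'b) tensor =
  "('a::real_vector \<times> 'b::real_vector) \<Rightarrow>\<^sub>0 real" / "\<lambda>p q. p - q \<in> span tensor_relators"
  morphisms rep_tensor abs_tensor
proof (rule equivpI)
  show "reflp (\<lambda>p q :: ('a \<times> 'b) \<Rightarrow>\<^sub>0 real. p - q \<in> span tensor_relators)"
    by (rule reflpI) (rule span_cong_refl)
  show "symp (\<lambda>p q :: ('a \<times> 'b) \<Rightarrow>\<^sub>0 real. p - q \<in> span tensor_relators)"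
    by (rule sympI) (rule span_cong_sym)
  show "transp (\<lambda>p q :: ('a \<times> 'b) \<Rightarrow>\<^sub>0 real. p - q \<in> span tensor_relators)"
    by (rule transpI) (rule span_cong_trans)
qed

instantiation tensor :: (real_vector, real_vector) real_vector
begin

lift_definition zero_tensor :: "('a, 'b) tensor" is 0 .

lift_definition plus_tensor :: "('a, 'b) tensor \<Rightarrow> ('a, 'b) tensor \<Rightarrow> ('a, 'b) tensor" is "(+)"
  by (rule span_cong_add)

lift_definition minus_tensor :: "('a, 'b) tensor \<Rightarrow> ('a, 'b) tensor \<Rightarrow> ('a, 'b) tensor" is "(-)"
  by (rule span_cong_diff)

lift_definition uminus_tensor :: "('a, 'b) tensor \<Rightarrow> ('a, 'b) tensor" is uminus
  by (rule span_cong_uminus)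

lift_definition scaleR_tensor :: "real \<Rightarrow> ('a, 'b) tensor \<Rightarrow> ('a, 'b) tensor" is scaleR
  by (rule span_cong_scaleR)

instance
  by standard (transfer, simp add: span_zero algebra_simps span_cong_refl)+

end

lift_definition tprod :: "'a::real_vector \<Rightarrow> 'b::real_vector \<Rightarrow> ('a, 'b) tensor"  (infixr \<open>\<otimes>\<^sub>t\<close> 75)
  is "\<lambda>x y. free_gen (x, y)" .

lemma linear_abs_tensor: "linear abs_tensor"
  by (rule linearI) (simp_all add: plus_tensor.abs_eq scaleR_tensor.abs_eq)

lemma tprod_eq: "x \<otimes>\<^sub>t y = abs_tensor (free_gen (x, y))"
  by (simp add: tprod.abs_eq)

lemma abs_tensor_relator: "r \<in> tensor_relators \<Longrightarrow> abs_tensor r = 0"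
  by (simp add: zero_tensor.abs_eq tensor.abs_eq_iff span_base)

lemma bilinear_tprod: "bilinear (\<otimes>\<^sub>t)"
  unfolding bilinear_def
proof (intro conjI allI linearI)
  note lin = linear_diff[OF linear_abs_tensor] linear_cmul[OF linear_abs_tensor]
  fix x x' :: 'a and y y' :: 'b and c :: real
  have "abs_tensor (free_gen (x, y + y') - free_gen (x, y) - free_gen (x, y')) = 0"
    by (rule abs_tensor_relator) (unfold tensor_relators_def, blast)
  then show "x \<otimes>\<^sub>t (y + y') = x \<otimes>\<^sub>t y + x \<otimes>\<^sub>t y'" by (simp only: tprod_eq lin) (simp add: algebra_simps)
  have "abs_tensor (free_gen (x + x', y) - free_gen (x, y) - free_gen (x', y)) = 0"
    by (rule abs_tensor_relator) (unfold tensor_relators_def, blast)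
  then show "(x + x') \<otimes>\<^sub>t y = x \<otimes>\<^sub>t y + x' \<otimes>\<^sub>t y" by (simp only: tprod_eq lin) (simp add: algebra_simps)
  have "abs_tensor (free_gen (x, c *\<^sub>R y) - c *\<^sub>R free_gen (x, y)) = 0"
    by (rule abs_tensor_relator) (unfold tensor_relators_def, blast)
  then show "x \<otimes>\<^sub>t (c *\<^sub>R y) = c *\<^sub>R (x \<otimes>\<^sub>t y)" by (simp only: tprod_eq lin) (simp add: algebra_simps)
  have "abs_tensor (free_gen (c *\<^sub>R x, y) - c *\<^sub>R free_gen (x, y)) = 0"
    by (rule abs_tensor_relator) (unfold tensor_relators_def, blast)
  then show "(c *\<^sub>R x) \<otimes>\<^sub>t y = c *\<^sub>R (x \<otimes>\<^sub>t y)" by (simp only: tprod_eq lin) (simp add: algebra_simps)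
qed

lemma tensor_universal:
  fixes f :: "'a::real_vector \<Rightarrow> 'b::real_vector \<Rightarrow> 'c::real_vector"
  assumes "bilinear f"
  shows "\<exists>!F. linear F \<and> (\<forall>x y. F (x \<otimes>\<^sub>t y) = f x y)"
proof -
  let ?L = "free_lift (\<lambda>(x, y). f x y)"
  have L: "linear ?L" by (rule linear_free_lift)
  have rel: "?L r = 0" if "r \<in> tensor_relators" for r
    using that assms unfolding tensor_relators_def
    by (auto simp: linear_diff[OF L] linear_cmul[OF L] bilinear_ladd bilinear_radd
        bilinear_lmul bilinear_rmul)
  have span: "?L r = 0" if "r \<in> span tensor_relators" for r
    using linear_eq_0_on_span[OF L rel that] .
  let ?F = "\<lambda>t. ?L (rep_tensor t)"
  have F: "?F (abs_tensor p) = ?L p" for p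
  proof -
    have "abs_tensor (rep_tensor (abs_tensor p)) = abs_tensor p"
      by (rule Quotient_abs_rep[OF Quotient_tensor])
    then have "rep_tensor (abs_tensor p) - p \<in> span tensor_relators"
      by (simp add: tensor.abs_eq_iff)
    then show ?thesis using span linear_diff[OF L] by (metis right_minus_eq)
  qed
  have ex: "\<exists>p. t = abs_tensor p" for t :: "('a, 'b) tensor"
    by (metis Quotient_abs_rep[OF Quotient_tensor])
  have linF: "linear ?F"
  proof (rule linearI)
    fix s t :: "('a, 'b) tensor" and c :: real
    obtain p q where "s = abs_tensor p" "t = abs_tensor q" using ex by metis
    then show "?F (s + t) = ?F s + ?F t" "?F (c *\<^sub>R s) = c *\<^sub>R ?F s"
      by (simp_all add: plus_tensor.abs_eq scaleR_tensor.abs_eq F linear_add[OF L] linear_cmul[OF L])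
  qed
  show ?thesis
  proof (rule ex1I[of _ ?F])
    show "linear ?F \<and> (\<forall>x y. ?F (x \<otimes>\<^sub>t y) = f x y)"
      using linF by (simp add: tprod_eq F)
  next
    fix G assume G: "linear G \<and> (\<forall>x y. G (x \<otimes>\<^sub>t y) = f x y)"
    have "G (abs_tensor p) = ?F (abs_tensor p)" for p
    proof -
      have "(G \<circ> abs_tensor) p = ?L p"
        by (rule linear_eq_on_free_gen[OF linear_compose[OF linear_abs_tensor] L])
          (use G in \<open>auto simp: tprod_eq\<close>)
      then show ?thesis by (simp add: F)
    qed
    then show "G = ?F" using ex by (metis ext)
  qed
qed

definition tensor_lift ::
    "('a::real_vector \<Rightarrow> 'b::real_vector \<Rightarrow> 'c::real_vector) \<Rightarrow> ('a, 'b) tensor \<Rightarrow> 'c" where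
  "tensor_lift f = (THE F. linear F \<and> (\<forall>x y. F (x \<otimes>\<^sub>t y) = f x y))"

section \<open>Exterior powers\<close>

text \<open>
  The exterior power \<open>\<Lambda>\<^sup>k V\<close> is the free vector space on the families \<open>'k \<Rightarrow> V\<close> (with \<open>'k\<close> finite of
  cardinality \<open>k\<close>; below \<open>'k\<close> is one of the numeral types \<open>2\<close> and \<open>3\<close>) modulo multilinearity and
  the vanishing of families with a repeated entry.
\<close>

definition ext_relators :: "(('k \<Rightarrow> 'a::real_vector) \<Rightarrow>\<^sub>0 real) set" where
  "ext_relators =
     {free_gen (x(i := a + b)) - free_gen (x(i := a)) - free_gen (x(i := b)) | x i a b. True} \<union>
     {free_gen (x(i := c *\<^sub>R a)) - c *\<^sub>R free_gen (x(i := a)) | x i c a. True} \<union>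
     {free_gen x | x. \<exists>i j. i \<noteq> j \<and> x i = x j}"

quotient_type (overloaded) ('a, 'k) ext_power =
  "('k::finite \<Rightarrow> 'a::real_vector) \<Rightarrow>\<^sub>0 real" / "\<lambda>p q. p - q \<in> span ext_relators"
  morphisms rep_ext abs_ext
proof (rule equivpI)
  show "reflp (\<lambda>p q :: ('k \<Rightarrow> 'a) \<Rightarrow>\<^sub>0 real. p - q \<in> span ext_relators)"
    by (rule reflpI) (rule span_cong_refl)
  show "symp (\<lambda>p q :: ('k \<Rightarrow> 'a) \<Rightarrow>\<^sub>0 real. p - q \<in> span ext_relators)"
    by (rule sympI) (rule span_cong_sym)
  show "transp (\<lambda>p q :: ('k \<Rightarrow> 'a) \<Rightarrow>\<^sub>0 real. p - q \<in> span ext_relators)"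
    by (rule transpI) (rule span_cong_trans)
qed

instantiation ext_power :: (real_vector, finite) real_vector
begin

lift_definition zero_ext_power :: "('a, 'b) ext_power" is 0 .

lift_definition plus_ext_power :: "('a, 'b) ext_power \<Rightarrow> ('a, 'b) ext_power \<Rightarrow> ('a, 'b) ext_power" is "(+)"
  by (rule span_cong_add)

lift_definition minus_ext_power :: "('a, 'b) ext_power \<Rightarrow> ('a, 'b) ext_power \<Rightarrow> ('a, 'b) ext_power" is "(-)"
  by (rule span_cong_diff)

lift_definition uminus_ext_power :: "('a, 'b) ext_power \<Rightarrow> ('a, 'b) ext_power" is uminus
  by (rule span_cong_uminus)

lift_definition scaleR_ext_power :: "real \<Rightarrow> ('a, 'b) ext_power \<Rightarrow> ('a, 'b) ext_power" is scaleR
  by (rule span_cong_scaleR)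

instance
  by standard (transfer, simp add: span_zero algebra_simps span_cong_refl)+

end

lift_definition wedge :: "('k::finite \<Rightarrow> 'a::real_vector) \<Rightarrow> ('a, 'k) ext_power"
  is free_gen .

definition multilinear :: "(('k \<Rightarrow> 'a::real_vector) \<Rightarrow> 'c::real_vector) \<Rightarrow> bool" where
  "multilinear f \<longleftrightarrow> (\<forall>x i. linear (\<lambda>a. f (x(i := a))))"

definition alternating :: "(('k \<Rightarrow> 'a) \<Rightarrow> 'c::zero) \<Rightarrow> bool" where
  "alternating f \<longleftrightarrow> (\<forall>x. (\<exists>i j. i \<noteq> j \<and> x i = x j) \<longrightarrow> f x = 0)"

lemma linear_abs_ext: "linear abs_ext"
  by (rule linearI) (simp_all add: plus_ext_power.abs_eq scaleR_ext_power.abs_eq)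

lemma wedge_eq: "wedge x = abs_ext (free_gen x)"
  by (simp add: wedge.abs_eq)

lemma abs_ext_relator: "r \<in> ext_relators \<Longrightarrow> abs_ext r = 0"
  by (simp add: zero_ext_power.abs_eq ext_power.abs_eq_iff span_base)

lemma multilinear_wedge: "multilinear wedge"
  unfolding multilinear_def
proof (intro allI linearI)
  note lin = linear_diff[OF linear_abs_ext] linear_cmul[OF linear_abs_ext]
  fix x :: "'a \<Rightarrow> 'b" and i :: 'a and a b :: 'b and c :: real
  have "abs_ext (free_gen (x(i := a + b)) - free_gen (x(i := a)) - free_gen (x(i := b))) = 0"
    by (rule abs_ext_relator) (unfold ext_relators_def, blast)
  then show "wedge (x(i := a + b)) = wedge (x(i := a)) + wedge (x(i := b))"
    by (simp only: wedge_eq lin) (simp add: algebra_simps)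
  have "abs_ext (free_gen (x(i := c *\<^sub>R a)) - c *\<^sub>R free_gen (x(i := a))) = 0"
    by (rule abs_ext_relator) (unfold ext_relators_def, blast)
  then show "wedge (x(i := c *\<^sub>R a)) = c *\<^sub>R wedge (x(i := a))"
    by (simp only: wedge_eq lin) (simp add: algebra_simps)
qed

lemma alternating_wedge: "alternating wedge"
  unfolding alternating_def wedge_eq
  by (intro allI impI abs_ext_relator) (unfold ext_relators_def, blast)

lemma ext_universal:
  fixes f :: "('k::finite \<Rightarrow> 'a::real_vector) \<Rightarrow> 'c::real_vector"
  assumes "multilinear f" "alternating f"
  shows "\<exists>!F. linear F \<and> (\<forall>x. F (wedge x) = f x)"
proof -
  let ?L = "free_lift f"
  have L: "linear ?L" by (rule linear_free_lift)
  have add: "f (x(i := a + b)) = f (x(i := a)) + f (x(i := b))" for x i a b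
    using assms(1) linear_add unfolding multilinear_def by blast
  have scale: "f (x(i := c *\<^sub>R a)) = c *\<^sub>R f (x(i := a))" for x i a c
    using assms(1) linear_cmul unfolding multilinear_def by blast
  have alt: "f x = 0" if "i \<noteq> j" "x i = x j" for x i j
    using assms(2) that unfolding alternating_def by blast
  have rel: "?L r = 0" if "r \<in> ext_relators" for r
    using that alt unfolding ext_relators_def
    by (auto simp: linear_diff[OF L] linear_cmul[OF L] add scale)
  have span: "?L r = 0" if "r \<in> span ext_relators" for r
    using linear_eq_0_on_span[OF L rel that] .
  let ?F = "\<lambda>t. ?L (rep_ext t)"
  have F: "?F (abs_ext p) = ?L p" for p
  proof -
    have "abs_ext (rep_ext (abs_ext p)) = abs_ext p"
      by (rule Quotient_abs_rep[OF Quotient_ext_power])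
    then have "rep_ext (abs_ext p) - p \<in> span ext_relators"
      by (simp add: ext_power.abs_eq_iff)
    then show ?thesis using span linear_diff[OF L] by (metis right_minus_eq)
  qed
  have ex: "\<exists>p. t = abs_ext p" for t :: "('a, 'k) ext_power"
    by (metis Quotient_abs_rep[OF Quotient_ext_power])
  have linF: "linear ?F"
  proof (rule linearI)
    fix s t :: "('a, 'k) ext_power" and c :: real
    obtain p q where "s = abs_ext p" "t = abs_ext q" using ex by metis
    then show "?F (s + t) = ?F s + ?F t" "?F (c *\<^sub>R s) = c *\<^sub>R ?F s"
      by (simp_all add: plus_ext_power.abs_eq scaleR_ext_power.abs_eq F linear_add[OF L] linear_cmul[OF L])
  qed
  show ?thesis
  proof (rule ex1I[of _ ?F])
    show "linear ?F \<and> (\<forall>x. ?F (wedge x) = f x)"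
      using linF by (simp add: wedge_eq F)
  next
    fix G assume G: "linear G \<and> (\<forall>x. G (wedge x) = f x)"
    have "G (abs_ext p) = ?F (abs_ext p)" for p
    proof -
      have "(G \<circ> abs_ext) p = ?L p"
        by (rule linear_eq_on_free_gen[OF linear_compose[OF linear_abs_ext] L])
          (use G in \<open>auto simp: wedge_eq\<close>)
      then show ?thesis by (simp add: F)
    qed
    then show "G = ?F" using ex by (metis ext)
  qed
qed

definition ext_lift :: "(('k::finite \<Rightarrow> 'a::real_vector) \<Rightarrow> 'c::real_vector) \<Rightarrow> ('a, 'k) ext_power \<Rightarrow> 'c" where
  "ext_lift f = (THE F. linear F \<and> (\<forall>x. F (wedge x) = f x))"

section \<open>Modules over a Lie algebra\<close>

text \<open>An action of \<open>\<gg>\<close> on a real vector space is given by the operators \<open>\<rho> X\<close> for \<open>X \<in> \<gg>\<close>.\<close>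

definition tensor_act ::
    "('g \<Rightarrow> 'a::real_vector \<Rightarrow> 'a) \<Rightarrow> ('g \<Rightarrow> 'b::real_vector \<Rightarrow> 'b) \<Rightarrow> 'g \<Rightarrow> ('a, 'b) tensor \<Rightarrow> ('a, 'b) tensor" where
  "tensor_act \<rho> \<sigma> X = tensor_lift (\<lambda>x y. \<rho> X x \<otimes>\<^sub>t y + x \<otimes>\<^sub>t \<sigma> X y)"

definition ext_act ::
    "('g \<Rightarrow> 'a::real_vector \<Rightarrow> 'a) \<Rightarrow> 'g \<Rightarrow> ('a, 'k::finite) ext_power \<Rightarrow> ('a, 'k) ext_power" where
  "ext_act \<rho> X = ext_lift (\<lambda>x. \<Sum>i\<in>UNIV. wedge (x(i := \<rho> X (x i))))"

definition trivial_act :: "'g \<Rightarrow> 'a::real_vector \<Rightarrow> 'a" where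
  "trivial_act X v = 0"

definition Lie_Hom ::
    "'g set \<Rightarrow> ('g \<Rightarrow> 'a::real_vector \<Rightarrow> 'a) \<Rightarrow> ('g \<Rightarrow> 'b::real_vector \<Rightarrow> 'b) \<Rightarrow> ('a \<Rightarrow> 'b) set" where
  "Lie_Hom \<gg> \<rho> \<sigma> = {f. linear f \<and> (\<forall>X\<in>\<gg>. \<forall>v. f (\<rho> X v) = \<sigma> X (f v))}"

lemma subspace_Lie_Hom:
  assumes "\<And>X. X \<in> \<gg> \<Longrightarrow> linear (\<sigma> X)"
  shows "subspace (Lie_Hom \<gg> \<rho> \<sigma>)"
  unfolding subspace_def
proof (intro conjI ballI allI)
  note lin = linear_0[OF assms] linear_add[OF assms] linear_cmul[OF assms]
  show "0 \<in> Lie_Hom \<gg> \<rho> \<sigma>"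
    using lin by (simp add: Lie_Hom_def linear_iff)
  fix f g c assume "f \<in> Lie_Hom \<gg> \<rho> \<sigma>"
  then have f: "linear f" "\<And>X v. X \<in> \<gg> \<Longrightarrow> f (\<rho> X v) = \<sigma> X (f v)" by (auto simp: Lie_Hom_def)
  then show "c *\<^sub>R f \<in> Lie_Hom \<gg> \<rho> \<sigma>"
    using lin by (simp add: Lie_Hom_def linear_iff scaleR_fun_def algebra_simps)
  assume "g \<in> Lie_Hom \<gg> \<rho> \<sigma>"
  then have g: "linear g" "\<And>X v. X \<in> \<gg> \<Longrightarrow> g (\<rho> X v) = \<sigma> X (g v)" by (auto simp: Lie_Hom_def)
  show "f + g \<in> Lie_Hom \<gg> \<rho> \<sigma>"
    using lin f g by (simp add: Lie_Hom_def linear_iff algebra_simps)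
qed

lemma tensor_act:
  assumes "linear (\<rho> X)" "linear (\<sigma> X)"
  shows "linear (tensor_act \<rho> \<sigma> X)"
    and "tensor_act \<rho> \<sigma> X (x \<otimes>\<^sub>t y) = \<rho> X x \<otimes>\<^sub>t y + x \<otimes>\<^sub>t \<sigma> X y"
proof -
  have "bilinear (\<lambda>x y. \<rho> X x \<otimes>\<^sub>t y + x \<otimes>\<^sub>t \<sigma> X y)"
    unfolding bilinear_def linear_iff
    by (simp add: linear_add[OF assms(1)] linear_add[OF assms(2)] linear_cmul[OF assms(1)]
        linear_cmul[OF assms(2)] bilinear_ladd[OF bilinear_tprod] bilinear_radd[OF bilinear_tprod]
        bilinear_lmul[OF bilinear_tprod] bilinear_rmul[OF bilinear_tprod] algebra_simps)
  from theI'[OF tensor_universal[OF this]]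
  show "linear (tensor_act \<rho> \<sigma> X)"
    and "tensor_act \<rho> \<sigma> X (x \<otimes>\<^sub>t y) = \<rho> X x \<otimes>\<^sub>t y + x \<otimes>\<^sub>t \<sigma> X y"
    unfolding tensor_act_def tensor_lift_def by blast+
qed

lemma alternating_swap:
  assumes "multilinear f" "alternating f" "i \<noteq> j"
  shows "f (x(i := a, j := b)) + f (x(i := b, j := a)) = 0"
proof -
  have add: "f (x(i := a + b)) = f (x(i := a)) + f (x(i := b))" for x i a b
    using assms(1) linear_add unfolding multilinear_def by blast
  have z: "f (x(i := c, j := c)) = 0" for c
    using assms(2,3) unfolding alternating_def by (metis fun_upd_other fun_upd_same)
  have "0 = f (x(i := a + b, j := a + b))" using z by simp
  also have "\<dots> = f (x(i := a + b, j := a)) + f (x(i := a + b, j := b))"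
    by (rule add)
  also have "\<dots> = f (x(j := a, i := a + b)) + f (x(j := b, i := a + b))"
    using assms(3) by (metis fun_upd_twist)
  also have "\<dots> = f (x(j := a, i := a)) + f (x(j := a, i := b))
      + (f (x(j := b, i := a)) + f (x(j := b, i := b)))"
    by (simp only: add)
  also have "\<dots> = f (x(i := b, j := a)) + f (x(i := a, j := b))"
    using assms(3) z by (metis fun_upd_twist add_0 add.right_neutral)
  finally show ?thesis by (simp add: add.commute)
qed

lemma ext_act:
  fixes x :: "'k::finite \<Rightarrow> 'a::real_vector"
  assumes "linear (\<rho> X)"
  shows "linear (ext_act \<rho> X :: ('a, 'k) ext_power \<Rightarrow> _)"
    and "ext_act \<rho> X (wedge x) = (\<Sum>i\<in>UNIV. wedge (x(i := \<rho> X (x i))))"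
proof -
  let ?f = "\<lambda>x :: 'k \<Rightarrow> 'a. \<Sum>i\<in>UNIV. wedge (x(i := \<rho> X (x i)))"
  have lw: "linear (\<lambda>a. wedge (x(i := a)))" for x :: "'k \<Rightarrow> 'a" and i
    using multilinear_wedge unfolding multilinear_def by blast
  have mult: "multilinear ?f"
    unfolding multilinear_def
  proof (intro allI linear_compose_sum ballI finite)
    fix x :: "'k \<Rightarrow> 'a" and i j :: 'k
    show "linear (\<lambda>a. wedge ((x(i := a))(j := \<rho> X ((x(i := a)) j))))"
    proof (cases "i = j")
      case True
      then show ?thesis
        using linear_compose[OF assms lw[of x j]] by (simp add: o_def)
    next
      case False
      then show ?thesis
        using lw[of "x(j := \<rho> X (x j))" i] by (simp add: fun_upd_twist)
    qed
  qed
  have alt: "alternating ?f"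
    unfolding alternating_def
  proof (intro allI impI)
    fix x :: "'k \<Rightarrow> 'a" assume "\<exists>i j. i \<noteq> j \<and> x i = x j"
    then obtain i j where ij: "i \<noteq> j" "x i = x j" by blast
    have z: "wedge (x(l := \<rho> X (x l))) = 0" if "l \<notin> {i, j}" for l
      using alternating_wedge that ij unfolding alternating_def
      by (metis fun_upd_other insertCI)
    have "?f x = (\<Sum>l\<in>{i, j}. wedge (x(l := \<rho> X (x l))))"
      by (rule sum.mono_neutral_right) (use z in auto)
    also have "\<dots> = wedge (x(i := \<rho> X (x i), j := x i)) + wedge (x(i := x i, j := \<rho> X (x i)))"
      using ij by (simp add: fun_upd_idem)
    also have "\<dots> = 0"
      using alternating_swap[OF multilinear_wedge alternating_wedge ij(1)] .
    finally show "?f x = 0" .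
  qed
  from theI'[OF ext_universal[OF mult alt]]
  show "linear (ext_act \<rho> X :: ('a, 'k) ext_power \<Rightarrow> _)"
    and "ext_act \<rho> X (wedge x) = ?f x"
    unfolding ext_act_def ext_lift_def by blast+
qed

section \<open>The reductive decomposition\<close>

text \<open>Row and column indices of matrices in blocks \<open>1 + n + 1\<close>, where \<open>n\<close> is the cardinality of \<open>'n\<close>.\<close>

type_synonym 'n blocks = "unit + 'n + unit"

type_synonym 'n block_matrix = "complex ^ 'n blocks ^ 'n blocks"

definition cadjoint :: "complex ^ 'n ^ 'n \<Rightarrow> complex ^ 'n ^ 'n" where
  "cadjoint A = (\<chi> i j. cnj (A $ j $ i))"

definition unitary_algebra :: "(complex ^ 'n ^ 'n) set"  (\<open>\<uu>\<close>) where
  "\<uu> = {A. A + cadjoint A = 0}"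

definition special_unitary_algebra :: "(complex ^ 'n ^ 'n) set"  (\<open>\<ss>\<uu>\<close>) where
  "\<ss>\<uu> = {A. A + cadjoint A = 0 \<and> trace A = 0}"

definition bracket :: "complex ^ 'n ^ 'n \<Rightarrow> complex ^ 'n ^ 'n \<Rightarrow> complex ^ 'n ^ 'n" where
  "bracket A B = A ** B - B ** A"

definition vcnj :: "complex ^ 'n \<Rightarrow> complex ^ 'n" where
  "vcnj z = (\<chi> i. cnj (z $ i))"

text \<open>The arguments are the nine blocks of the matrix, row by row.\<close>

definition block_mat ::
    "complex \<Rightarrow> complex ^ 'n \<Rightarrow> complex \<Rightarrow>
     complex ^ 'n \<Rightarrow> complex ^ 'n ^ 'n \<Rightarrow> complex ^ 'n \<Rightarrow>
     complex \<Rightarrow> complex ^ 'n \<Rightarrow> complex \<Rightarrow> 'n block_matrix" where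
  "block_mat a r b  c B d  e s f = (\<chi> i j.
     (case i of
        Inl _ \<Rightarrow> (case j of Inl _ \<Rightarrow> a | Inr (Inl l) \<Rightarrow> r $ l | Inr (Inr _) \<Rightarrow> b)
      | Inr (Inl k) \<Rightarrow> (case j of Inl _ \<Rightarrow> c $ k | Inr (Inl l) \<Rightarrow> B $ k $ l | Inr (Inr _) \<Rightarrow> d $ k)
      | Inr (Inr _) \<Rightarrow> (case j of Inl _ \<Rightarrow> e | Inr (Inl l) \<Rightarrow> s $ l | Inr (Inr _) \<Rightarrow> f)))"

definition h_mat :: "complex ^ 'n ^ 'n \<Rightarrow> 'n block_matrix" where
  "h_mat B = block_mat
     (- trace B / 2) 0 0
     0               B 0
     0               0 (- trace B / 2)"

definition m_mat :: "real \<Rightarrow> complex ^ 'n \<Rightarrow> complex ^ 'n \<Rightarrow> complex \<Rightarrow> 'n block_matrix" where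
  "m_mat \<alpha> z1 z2 w = block_mat
     (of_real \<alpha> * \<i>) z2          w
     (- vcnj z2)      0           z1
     (- cnj w)        (- vcnj z1) (- (of_real \<alpha> * \<i>))"

definition isotropy_algebra :: "'n::finite block_matrix set"  (\<open>\<hh>\<close>) where
  "\<hh> = {h_mat B | B. B \<in> \<uu>}"

definition reductive_complement :: "'n::finite block_matrix set"  (\<open>\<mm>\<close>) where
  "\<mm> = {m_mat \<alpha> z1 z2 w | \<alpha> z1 z2 w. True}"

lemma card_blocks: "CARD('n::finite blocks) = CARD('n) + 2"
  by (simp add: card_UNIV_sum)

lemma m_mat_add: "m_mat \<alpha> z1 z2 w + m_mat \<beta> y1 y2 v = m_mat (\<alpha> + \<beta>) (z1 + y1) (z2 + y2) (w + v)"
  by (auto simp: vec_eq_iff m_mat_def block_mat_def vcnj_def algebra_simps split: sum.split)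

lemma m_mat_scaleR: "c *\<^sub>R m_mat \<alpha> z1 z2 w = m_mat (c * \<alpha>) (c *\<^sub>R z1) (c *\<^sub>R z2) (c *\<^sub>R w)"
  by (auto simp: vec_eq_iff m_mat_def block_mat_def vcnj_def
      scaleR_conv_of_real[where 'a = complex] algebra_simps split: sum.split)

lemma m_mat_zero: "m_mat 0 0 0 0 = 0"
  by (auto simp: vec_eq_iff m_mat_def block_mat_def vcnj_def split: sum.split)

lemma subspace_m: "subspace (\<mm> :: 'n::finite block_matrix set)"
  unfolding subspace_def reductive_complement_def
proof (intro conjI ballI allI)
  show "0 \<in> {m_mat \<alpha> z1 z2 w | \<alpha> z1 z2 w. True}" using m_mat_zero by (metis (mono_tags) mem_Collect_eq)
next
  fix X Y :: "'n block_matrix" and c :: real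
  assume "X \<in> {m_mat \<alpha> z1 z2 w | \<alpha> z1 z2 w. True}"
  then obtain \<alpha> z1 z2 w where X: "X = m_mat \<alpha> z1 z2 w" by blast
  show "c *\<^sub>R X \<in> {m_mat \<alpha> z1 z2 w | \<alpha> z1 z2 w. True}" unfolding X m_mat_scaleR by blast
  assume "Y \<in> {m_mat \<alpha> z1 z2 w | \<alpha> z1 z2 w. True}"
  then obtain \<beta> y1 y2 v where Y: "Y = m_mat \<beta> y1 y2 v" by blast
  show "X + Y \<in> {m_mat \<alpha> z1 z2 w | \<alpha> z1 z2 w. True}" unfolding X Y m_mat_add by blast
qed

lemma sum_blocks: "(\<Sum>i\<in>UNIV. f i) = f (Inl ()) + (\<Sum>k\<in>UNIV. f (Inr (Inl k))) + f (Inr (Inr ()))"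
  for f :: "'n::finite blocks \<Rightarrow> 'a::comm_monoid_add"
proof -
  have sum2: "sum g UNIV = (\<Sum>x\<in>UNIV. g (Inl x)) + (\<Sum>y\<in>UNIV. g (Inr y))"
    for g :: "'p::finite + 'q::finite \<Rightarrow> 'a"
    using sum.Plus[of "UNIV :: 'p set" "UNIV :: 'q set" g]
    by (simp add: UNIV_Plus_UNIV o_def)
  show ?thesis
    by (simp add: sum2 UNIV_unit add.assoc)
qed

lemma u_entry: "B \<in> \<uu> \<Longrightarrow> cnj (B $ i $ j) = - (B $ j $ i)"
  by (simp add: unitary_algebra_def cadjoint_def vec_eq_iff) (metis add_eq_0_iff complex_cnj_cnj)

lemma trace_u: "B \<in> \<uu> \<Longrightarrow> cnj (trace B) = - trace B"
  by (simp add: trace_def u_entry sum_negf)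

lemma bracket_h_mat_m_mat:
  assumes "B \<in> \<uu>"
  shows "bracket (h_mat B) (m_mat \<alpha> z1 z2 w) =
    m_mat 0 (B *v z1 + (trace B / 2) *s z1) (- (transpose B *v z2) - (trace B / 2) *s z2) 0"
proof -
  have t: "cnj (trace B) = - trace B" by (rule trace_u[OF assms])
  show ?thesis
    by (auto simp: vec_eq_iff bracket_def matrix_matrix_mult_def h_mat_def m_mat_def block_mat_def
        vcnj_def sum_blocks matrix_vector_mult_def transpose_def t u_entry[OF assms] sum_negf
        algebra_simps split: sum.split)
qed

lemma bracket_h_m:
  assumes "X \<in> \<hh>" "Y \<in> \<mm>"
  shows "bracket X Y \<in> \<mm>"
  using assms bracket_h_mat_m_mat unfolding isotropy_algebra_def reductive_complement_def by blast

lemma trace_block_mat: "trace (block_mat a r b c B d e s f) = a + trace B + f"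
  by (simp add: trace_def sum_blocks block_mat_def)

lemma cadjoint_block_mat:
  "cadjoint (block_mat a r b c B d e s f) =
     block_mat (cnj a) (vcnj c) (cnj e) (vcnj r) (cadjoint B) (vcnj s) (cnj b) (vcnj d) (cnj f)"
  by (auto simp: vec_eq_iff cadjoint_def block_mat_def vcnj_def split: sum.split)

lemma block_mat_add:
  "block_mat a r b c B d e s f + block_mat a' r' b' c' B' d' e' s' f' =
     block_mat (a + a') (r + r') (b + b') (c + c') (B + B') (d + d') (e + e') (s + s') (f + f')"
  by (auto simp: vec_eq_iff block_mat_def split: sum.split)

lemma block_mat_zero: "block_mat 0 0 0 0 0 0 0 0 0 = 0"
  by (auto simp: vec_eq_iff block_mat_def split: sum.split)

lemma vcnj_simps: "vcnj 0 = 0" "vcnj (- z) = - vcnj z" "vcnj (vcnj z) = z"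
  by (simp_all add: vcnj_def vec_eq_iff)

lemma cadjoint_zero: "cadjoint 0 = 0"
  by (simp add: cadjoint_def vec_eq_iff)

lemma trace_zero: "trace 0 = 0"
  by (simp add: trace_def)

lemma h_subset_su: "\<hh> \<subseteq> \<ss>\<uu>"
proof
  fix X :: "'n::finite block_matrix" assume "X \<in> \<hh>"
  then obtain B where B: "B \<in> \<uu>" and X: "X = h_mat B"
    unfolding isotropy_algebra_def by blast
  have "B + cadjoint B = 0" using B by (simp add: unitary_algebra_def)
  then show "X \<in> \<ss>\<uu>"
    using trace_u[OF B]
    by (simp add: X special_unitary_algebra_def h_mat_def cadjoint_block_mat block_mat_add
        trace_block_mat vcnj_simps block_mat_zero)
qed

lemma m_subset_su: "\<mm> \<subseteq> \<ss>\<uu>"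
proof
  fix X :: "'n::finite block_matrix" assume "X \<in> \<mm>"
  then obtain \<alpha> z1 z2 w where X: "X = m_mat \<alpha> z1 z2 w"
    unfolding reductive_complement_def by blast
  show "X \<in> \<ss>\<uu>"
    by (simp add: X special_unitary_algebra_def m_mat_def cadjoint_block_mat block_mat_add
        trace_block_mat vcnj_simps cadjoint_zero trace_zero block_mat_zero)
qed

lemma h_Int_m: "\<hh> \<inter> (\<mm> :: 'n::finite block_matrix set) = {0}"
proof -
  have "X = 0" if h: "X \<in> \<hh>" and m: "X \<in> \<mm>" for X :: "'n block_matrix"
  proof -
    obtain B where X: "X = h_mat B" using h unfolding isotropy_algebra_def by blast
    obtain \<alpha> z1 z2 w where Y: "X = m_mat \<alpha> z1 z2 w"
      using m unfolding reductive_complement_def by blast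
    have B: "B = 0"
      using arg_cong[OF trans[OF X[symmetric] Y], of "\<lambda>A. \<chi> i j. A $ Inr (Inl i) $ Inr (Inl j)"]
      by (auto simp: vec_eq_iff h_mat_def m_mat_def block_mat_def)
    show ?thesis
      unfolding X B by (auto simp: vec_eq_iff h_mat_def block_mat_def trace_def split: sum.split)
  qed
  moreover have "0 \<in> \<hh>"
    unfolding isotropy_algebra_def
    by (auto intro!: exI[of _ 0]
      simp: vec_eq_iff h_mat_def block_mat_def trace_def unitary_algebra_def cadjoint_def split: sum.split)
  moreover have "0 \<in> \<mm>" by (rule subspace_0[OF subspace_m])
  ultimately show ?thesis by blast
qed

lemma su_eq_h_plus_m: "\<ss>\<uu> = {X + Y | X Y. X \<in> \<hh> \<and> Y \<in> (\<mm> :: 'n::finite block_matrix set)}"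
proof (intro equalityI subsetI)
  fix A :: "'n block_matrix"
  assume "A \<in> {X + Y | X Y. X \<in> \<hh> \<and> Y \<in> \<mm>}"
  then obtain X Y where A: "A = X + Y" and "X \<in> \<hh>" "Y \<in> \<mm>" by auto
  then have "X \<in> \<ss>\<uu>" "Y \<in> \<ss>\<uu>" using h_subset_su m_subset_su by auto
  then have X: "X + cadjoint X = 0" "trace X = 0" and Y: "Y + cadjoint Y = 0" "trace Y = 0"
    by (auto simp: special_unitary_algebra_def)
  have "A + cadjoint A = (X + cadjoint X) + (Y + cadjoint Y)"
    by (simp add: A cadjoint_def vec_eq_iff)
  then show "A \<in> \<ss>\<uu>"
    by (simp add: special_unitary_algebra_def X Y) (simp add: A trace_add X Y)
next
  fix A :: "'n block_matrix"
  assume A: "A \<in> \<ss>\<uu>"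
  then have tr: "trace A = 0" and sk: "\<And>i j. A $ i $ j = - cnj (A $ j $ i)"
    by (auto simp: special_unitary_algebra_def cadjoint_def vec_eq_iff eq_neg_iff_add_eq_0)
  have sk': "cnj (A $ i $ j) = - (A $ j $ i)" for i j
    using sk[of j i] by simp
  define B where "B = (\<chi> k l. A $ Inr (Inl k) $ Inr (Inl l))"
  define a where "a = Im (A $ Inl () $ Inl ())"
  define c where "c = Im (A $ Inr (Inr ()) $ Inr (Inr ()))"
  have im: "A $ i $ i = \<i> * of_real (Im (A $ i $ i))" for i
    using sk[of i i] by (auto simp: complex_eq_iff)
  have a: "A $ Inl () $ Inl () = \<i> * of_real a" and c: "A $ Inr (Inr ()) $ Inr (Inr ()) = \<i> * of_real c"
    unfolding a_def c_def by (rule im)+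
  have B: "B \<in> \<uu>"
    by (simp add: unitary_algebra_def B_def cadjoint_def vec_eq_iff sk')
  have "trace A = \<i> * of_real a + trace B + \<i> * of_real c"
    by (simp add: trace_def sum_blocks B_def a c)
  then have trB: "trace B = - (\<i> * of_real a) - \<i> * of_real c"
    using tr by (simp add: eq_diff_eq minus_equation_iff[of "\<i> * of_real a"] eq_neg_iff_add_eq_0 ac_simps)
  let ?M = "m_mat ((a - c) / 2) (\<chi> k. A $ Inr (Inl k) $ Inr (Inr ())) (\<chi> k. A $ Inl () $ Inr (Inl k))
              (A $ Inl () $ Inr (Inr ()))"
  have B_entry: "B $ k $ l = A $ Inr (Inl k) $ Inr (Inl l)" for k l
    by (simp add: B_def)
  have "A = h_mat B + ?M"
    by (auto simp: vec_eq_iff h_mat_def m_mat_def block_mat_def vcnj_def trB a c B_entry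
        sk' field_simps split: sum.split)
  moreover have "h_mat B \<in> \<hh>" using B by (auto simp: isotropy_algebra_def)
  moreover have "?M \<in> \<mm>" by (auto simp: reductive_complement_def)
  ultimately show "A \<in> {X + Y | X Y. X \<in> \<hh> \<and> Y \<in> \<mm>}" by blast
qed

text \<open>The complement \<open>\<mm>\<close> as a type, so that it can serve as an argument of the type constructors above.\<close>

typedef 'n m_space = "\<mm> :: 'n::finite block_matrix set"
  using subspace_0[OF subspace_m] by blast

setup_lifting type_definition_m_space

instantiation m_space :: (finite) real_vector
begin

lift_definition zero_m_space :: "'a m_space" is 0
  by (rule subspace_0[OF subspace_m])

lift_definition plus_m_space :: "'a m_space \<Rightarrow> 'a m_space \<Rightarrow> 'a m_space" is "(+)"
  by (rule subspace_add[OF subspace_m])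

lift_definition minus_m_space :: "'a m_space \<Rightarrow> 'a m_space \<Rightarrow> 'a m_space" is "(-)"
  by (rule subspace_diff[OF subspace_m])

lift_definition uminus_m_space :: "'a m_space \<Rightarrow> 'a m_space" is uminus
  by (rule subspace_neg[OF subspace_m])

lift_definition scaleR_m_space :: "real \<Rightarrow> 'a m_space \<Rightarrow> 'a m_space" is scaleR
  by (rule subspace_scale[OF subspace_m])

instance
  by standard (transfer, simp add: algebra_simps)+

end

text \<open>Meaningful for \<open>X \<in> \<hh>\<close>, where \<open>[X, x] \<in> \<mm>\<close>.\<close>

definition m_act :: "'n::finite block_matrix \<Rightarrow> 'n m_space \<Rightarrow> 'n m_space" where
  "m_act X x = Abs_m_space (bracket X (Rep_m_space x))"

lemma Rep_m_act: "X \<in> \<hh> \<Longrightarrow> Rep_m_space (m_act X x) = bracket X (Rep_m_space x)"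
  by (simp add: m_act_def Abs_m_space_inverse bracket_h_m Rep_m_space)

lemma bracket_add_right: "bracket X (A + B) = bracket X A + bracket X B"
  by (simp add: bracket_def matrix_matrix_mult_def vec_eq_iff sum.distrib algebra_simps)

lemma bracket_scaleR_right: "bracket X (c *\<^sub>R A) = c *\<^sub>R bracket X A"
  by (simp add: bracket_def matrix_matrix_mult_def vec_eq_iff scaleR_sum_right scaleR_diff_right)

lemma linear_m_act: "X \<in> \<hh> \<Longrightarrow> linear (m_act X)"
  by (rule linearI)
    (simp_all add: Rep_m_space_inject[symmetric] Rep_m_act plus_m_space.rep_eq scaleR_m_space.rep_eq
      bracket_add_right bracket_scaleR_right)

end

theory Submission
  imports Defs
begin

text \<open>
  Let \<open>V\<close> be \<open>\<complex>\<^sup>n\<close> with the standard action of \<open>\<uu>(n)\<close>. The element of \<open>\<hh>\<close> given by \<open>B\<close> acts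
  on \<open>z\<^sub>1\<close> and on \<open>vcnj z\<^sub>2\<close> by the matrix \<open>B + (tr B / 2) I\<close> and kills \<open>\<alpha>\<close> and \<open>w\<close>. The map
  \<open>B \<mapsto> B + (tr B / 2) I\<close> is a bijection of \<open>\<uu>(n)\<close>, so as a representation of \<open>\<uu>(n)\<close> the module \<open>\<mm>\<close> is
  \<open>\<real>\<^sup>3 \<oplus> V \<oplus> V\<close> with trivial action on \<open>\<real>\<^sup>3\<close> (lemmas \<open>isotropy_acts_as_u\<close> and
  \<open>u_acts_through_isotropy\<close>).

  This module carries an invariant inner product, and for any finite-dimensional module with an
  invariant inner product the three spaces of homomorphisms are spaces of invariant trilinear
  forms: \<open>f : \<mm> \<otimes> \<mm> \<rightarrow> \<mm>\<close> becomes \<open>\<langle>f (x \<otimes> y), z\<rangle>\<close>, \<open>f : \<mm> \<rightarrow> \<Lambda>\<^sup>2\<mm>\<close> becomes \<open>\<langle>f x, y \<and> z\<rangle>\<close>, which is skew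
  in the last two arguments, and \<open>f : \<Lambda>\<^sup>3\<mm> \<rightarrow> \<real>\<close> is an alternating form already. This is the content
  of the locale \<open>invariant_inner_product\<close>.

  It remains to find the invariant trilinear forms on \<open>\<real>\<^sup>3 \<oplus> V\<^sup>2\<close> (lemma \<open>invariant_is_coord_form\<close>).
  The element \<open>i I\<close> of \<open>\<uu>(n)\<close> acts as \<open>0\<close> on \<open>\<real>\<^sup>3\<close> and as multiplication by \<open>i\<close> on \<open>V\<^sup>2\<close>; this forces a
  form to vanish whenever one argument or all three arguments lie in \<open>V\<^sup>2\<close> and the others in \<open>\<real>\<^sup>3\<close>.
  On \<open>\<real>\<^sup>3 \<times> \<real>\<^sup>3 \<times> \<real>\<^sup>3\<close> every trilinear form is invariant. Finally, the invariant real bilinear forms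
  on \<open>V\<close> are the real parts of the complex multiples of the Hermitian form, because an operator
  that commutes with \<open>\<uu>(n)\<close> is a complex scalar. So an invariant form is given by a \<open>3 \<times> 3 \<times> 3\<close> array
  \<open>A\<close> and, for each of the three places that the argument from \<open>\<real>\<^sup>3\<close> can take, by a triple of complex
  \<open>2 \<times> 2\<close> matrices, \<open>P\<close>, \<open>Q\<close> and \<open>R\<close>: the dimension is \<open>27 + 3 \<cdot> 24 = 99\<close>. Skewness in the last two
  arguments says that \<open>A\<close> is skew in its last two indices, that the matrices in \<open>P\<close> are
  skew-Hermitian and that \<open>R = - Q\<close>: \<open>9 + 12 + 24 = 45\<close>. A form is alternating if moreover \<open>A\<close> is a
  multiple of the determinant, \<open>Q = - P\<close> and \<open>R = P\<close>: \<open>1 + 12 = 13\<close>.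
\<close>

section \<open>Dimension under injective linear maps\<close>

text \<open>
  A basis of the subspace is carried to a basis of its image. The codomain is not assumed to be
  finite-dimensional, since the maps below take values in spaces of functions.
\<close>

lemma dim_image_inj_on:
  fixes T :: "'a::real_vector \<Rightarrow> 'b::real_vector"
  assumes T: "linear T" and S: "subspace S" and inj: "inj_on T S"
  shows "dim (T ` S) = dim S"
proof -
  obtain B where B: "B \<subseteq> S" "independent B" "S \<subseteq> span B" "card B = dim S"
    by (rule basis_exists)
  then have span: "span B = S"
    using S by (simp add: span_subspace)
  have "independent (T ` B)"
    using linear_independent_injective_image[OF T B(2)] inj span by simp
  moreover have "span (T ` B) = span (T ` S)"
    using linear_span_image[OF T] span by (metis span_span)
  ultimately have "dim (T ` S) = card (T ` B)"
    by (intro dim_eq_card)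
  also have "\<dots> = card B"
    by (rule card_image) (use inj B(1) inj_on_subset in blast)
  finally show ?thesis using B(4) by simp
qed

lemma dim_range_inj:
  fixes T :: "'p::euclidean_space \<Rightarrow> 'b::real_vector"
  assumes "linear T" "inj T"
  shows "dim (range T) = DIM('p)"
  using dim_image_inj_on[OF assms(1) subspace_UNIV] assms(2) by simp

section \<open>Homomorphisms as invariant trilinear forms\<close>

definition trilinear :: "('a::real_vector \<Rightarrow> 'b::real_vector \<Rightarrow> 'c::real_vector \<Rightarrow> 'd::real_vector) \<Rightarrow> bool" where
  "trilinear F \<longleftrightarrow> (\<forall>y z. linear (\<lambda>x. F x y z)) \<and> (\<forall>x z. linear (\<lambda>y. F x y z)) \<and> (\<forall>x y. linear (F x y))"

lemma trilinearD:
  assumes "trilinear F"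
  shows "linear (\<lambda>x. F x y z)" "linear (\<lambda>y. F x y z)" "linear (F x y)"
  using assms by (auto simp: trilinear_def)

definition invariant_forms :: "'g set \<Rightarrow> ('g \<Rightarrow> 'a::real_vector \<Rightarrow> 'a) \<Rightarrow> ('a \<Rightarrow> 'a \<Rightarrow> 'a \<Rightarrow> real) set" where
  "invariant_forms \<gg> \<rho> = {F. trilinear F \<and>
     (\<forall>X\<in>\<gg>. \<forall>x y z. F (\<rho> X x) y z + F x (\<rho> X y) z + F x y (\<rho> X z) = 0)}"

text \<open>
  The wedges span the exterior power, as the classes of the free generators.
\<close>

lemma linear_eq_on_wedge:
  fixes F G :: "('a::real_vector, 'k::finite) ext_power \<Rightarrow> 'c::real_vector"
  assumes "linear F" "linear G" "\<And>x. F (wedge x) = G (wedge x)"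
  shows "F t = G t"
proof -
  obtain p where p: "t = abs_ext p"
    by (metis Quotient_abs_rep[OF Quotient_ext_power])
  have "(F \<circ> abs_ext) p = (G \<circ> abs_ext) p"
    by (rule linear_eq_on_free_gen[OF linear_compose[OF linear_abs_ext assms(1)]
          linear_compose[OF linear_abs_ext assms(2)]])
      (use assms(3) in \<open>simp add: wedge_eq\<close>)
  then show ?thesis by (simp add: p)
qed

lemma linear_eq_on_tprod:
  fixes F G :: "('a::real_vector, 'b::real_vector) tensor \<Rightarrow> 'c::real_vector"
  assumes "linear F" "linear G" "\<And>x y. F (x \<otimes>\<^sub>t y) = G (x \<otimes>\<^sub>t y)"
  shows "F t = G t"
proof -
  have "bilinear (\<lambda>x y. F (x \<otimes>\<^sub>t y))"
    unfolding bilinear_def linear_iff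
    by (simp add: linear_add[OF assms(1)] linear_cmul[OF assms(1)] bilinear_ladd[OF bilinear_tprod]
        bilinear_radd[OF bilinear_tprod] bilinear_lmul[OF bilinear_tprod] bilinear_rmul[OF bilinear_tprod])
  from tensor_universal[OF this] have "F = G"
    using assms by metis
  then show ?thesis by simp
qed

text \<open>
  Families indexed by the types \<open>2\<close> and \<open>3\<close>, written by their entries, turn multilinear maps on
  families into bilinear and trilinear maps in the usual sense.
\<close>

definition pair_family :: "'a \<Rightarrow> 'a \<Rightarrow> 2 \<Rightarrow> 'a" where
  "pair_family x y = (\<lambda>i. if i = 1 then x else y)"

definition triple_family :: "'a \<Rightarrow> 'a \<Rightarrow> 'a \<Rightarrow> 3 \<Rightarrow> 'a" where
  "triple_family x y z = (\<lambda>i. if i = 1 then x else if i = 2 then y else z)"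

lemma pair_family_simps [simp]:
  "pair_family x y 1 = x" "pair_family x y 2 = y"
  "(pair_family x y)(1 := a) = pair_family a y" "(pair_family x y)(2 := a) = pair_family x a"
  by (auto simp: pair_family_def fun_eq_iff forall_2)

lemma triple_family_simps [simp]:
  "triple_family x y z 1 = x" "triple_family x y z 2 = y" "triple_family x y z 3 = z"
  "(triple_family x y z)(1 := a) = triple_family a y z"
  "(triple_family x y z)(2 := a) = triple_family x a z"
  "(triple_family x y z)(3 := a) = triple_family x y a"
  by (auto simp: triple_family_def fun_eq_iff forall_3)

lemma pair_family_eta: "w = pair_family (w 1) (w 2)"
  by (auto simp: fun_eq_iff forall_2)

lemma triple_family_eta: "w = triple_family (w 1) (w 2) (w 3)"
  by (auto simp: fun_eq_iff forall_3)

lemma multilinear_triple: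
  "multilinear f \<longleftrightarrow> trilinear (\<lambda>x y z. f (triple_family x y z))"
proof
  assume f: "multilinear f"
  have "linear (\<lambda>a. f ((triple_family x y z)(i := a)))" for x y z i
    using f by (simp add: multilinear_def)
  from this[of _ _ _ 1] this[of _ _ _ 2] this[of _ _ _ 3]
  show "trilinear (\<lambda>x y z. f (triple_family x y z))"
    by (simp add: trilinear_def)
next
  assume f: "trilinear (\<lambda>x y z. f (triple_family x y z))"
  have "linear (\<lambda>a. f ((triple_family x y z)(i := a)))" for x y z i
    using exhaust_3[of i] trilinearD[OF f] by auto
  then show "multilinear f"
    unfolding multilinear_def by (metis triple_family_eta)
qed

lemma multilinear_pair:
  "multilinear f \<longleftrightarrow> bilinear (\<lambda>x y. f (pair_family x y))"
proof
  assume f: "multilinear f"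
  have "linear (\<lambda>a. f ((pair_family x y)(i := a)))" for x y i
    using f by (simp add: multilinear_def)
  from this[of _ _ 1] this[of _ _ 2]
  show "bilinear (\<lambda>x y. f (pair_family x y))"
    by (simp add: bilinear_def)
next
  assume f: "bilinear (\<lambda>x y. f (pair_family x y))"
  have "linear (\<lambda>a. f ((pair_family x y)(i := a)))" for x y i
    using exhaust_2[of i] f by (auto simp: bilinear_def)
  then show "multilinear f"
    unfolding multilinear_def by (metis pair_family_eta)
qed

lemma alternating_pair:
  fixes f :: "(2 \<Rightarrow> 'a) \<Rightarrow> 'c::zero"
  shows "alternating f \<longleftrightarrow> (\<forall>x. f (pair_family x x) = 0)"
proof
  assume f: "alternating f"
  have "(1::2) \<noteq> 2" by simp
  then show "\<forall>x. f (pair_family x x) = 0"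
    using f unfolding alternating_def by (metis pair_family_simps(1,2))
next
  assume *: "\<forall>x. f (pair_family x x) = 0"
  show "alternating f"
    unfolding alternating_def
  proof (intro allI impI)
    fix w :: "2 \<Rightarrow> 'a" assume "\<exists>i j. i \<noteq> j \<and> w i = w j"
    then have "w 1 = w 2" by (metis exhaust_2)
    then show "f w = 0" using * by (metis pair_family_eta)
  qed
qed

lemma alternating_triple:
  fixes f :: "(3 \<Rightarrow> 'a) \<Rightarrow> 'c::zero"
  shows "alternating f \<longleftrightarrow> (\<forall>x y. f (triple_family x x y) = 0 \<and> f (triple_family x y x) = 0
           \<and> f (triple_family y x x) = 0)"
proof
  assume f: "alternating f"
  have "(1::3) \<noteq> 2" "(1::3) \<noteq> 3" "(2::3) \<noteq> 3" by simp_all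
  then show "\<forall>x y. f (triple_family x x y) = 0 \<and> f (triple_family x y x) = 0
           \<and> f (triple_family y x x) = 0"
    using f unfolding alternating_def by (metis triple_family_simps(1,2,3))
next
  assume *: "\<forall>x y. f (triple_family x x y) = 0 \<and> f (triple_family x y x) = 0
           \<and> f (triple_family y x x) = 0"
  show "alternating f"
    unfolding alternating_def
  proof (intro allI impI)
    fix w :: "3 \<Rightarrow> 'a" assume "\<exists>i j. i \<noteq> j \<and> w i = w j"
    then obtain i j where ij: "i \<noteq> j" "w i = w j" by blast
    then consider "w 1 = w 2" | "w 1 = w 3" | "w 2 = w 3"
      using exhaust_3[of i] exhaust_3[of j] by auto
    then show "f w = 0" using * by cases (metis triple_family_eta)+
  qed
qed

text \<open>
  A module with an invariant inner product \<open>ip\<close> and a finite orthonormal basis \<open>E\<close>. Orthonormality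
  enters only through the expansion \<open>x = \<Sum>e\<in>E. \<langle>x, e\<rangle> e\<close>.
\<close>

locale invariant_inner_product =
  fixes \<gg> :: "'g set" and \<rho> :: "'g \<Rightarrow> 'a::real_vector \<Rightarrow> 'a" and ip :: "'a \<Rightarrow> 'a \<Rightarrow> real" and E :: "'a set"
  assumes linear_act: "X \<in> \<gg> \<Longrightarrow> linear (\<rho> X)"
    and bilinear_ip: "bilinear ip"
    and ip_sym: "ip x y = ip y x"
    and finite_E: "finite E"
    and expand: "(\<Sum>e\<in>E. ip x e *\<^sub>R e) = x"
    and ip_act: "X \<in> \<gg> \<Longrightarrow> ip (\<rho> X x) y = - ip x (\<rho> X y)"
begin

lemma linear_ip: "linear (\<lambda>x. ip x y)" "linear (ip x)"
  using bilinear_ip by (auto simp: bilinear_def)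

lemmas ip_simps = linear_add[OF linear_ip(1)] linear_add[OF linear_ip(2)]
  linear_cmul[OF linear_ip(1)] linear_cmul[OF linear_ip(2)]

lemma ip_eqI:
  assumes "\<And>z. ip x z = ip y z"
  shows "x = y"
  by (subst (1 2) expand[symmetric]) (simp only: assms)

text \<open>
  The vector that represents a linear form has the values of the form as its coordinates.
\<close>

lemma riesz:
  assumes "linear \<phi>"
  shows "ip (\<Sum>e\<in>E. \<phi> e *\<^sub>R e) z = \<phi> z"
proof -
  have "\<phi> z = \<phi> (\<Sum>e\<in>E. ip z e *\<^sub>R e)" by (simp add: expand)
  also have "\<dots> = (\<Sum>e\<in>E. \<phi> e * ip e z)"
    by (simp add: linear_sum[OF assms] linear_cmul[OF assms] ip_sym mult.commute)
  finally show ?thesis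
    by (simp add: linear_sum[OF linear_ip(1)] linear_cmul[OF linear_ip(1)])
qed

text \<open>
  The isomorphism sends \<open>f\<close> to \<open>\<langle>f (x \<otimes> y), z\<rangle>\<close>. Since \<open>\<rho> X\<close> is skew for the inner product,
  equivariance of \<open>f\<close> is invariance of the form; representing \<open>F x y\<close> by a vector inverts the map.
\<close>

lemma dim_Hom_tensor:
  "dim (Lie_Hom \<gg> (tensor_act \<rho> \<rho>) \<rho>) = dim (invariant_forms \<gg> \<rho>)"
proof -
  let ?H = "Lie_Hom \<gg> (tensor_act \<rho> \<rho>) \<rho>"
  let ?T = "\<lambda>f x y z. ip (f (x \<otimes>\<^sub>t y)) z"
  note bil = bilinear_ladd[OF bilinear_tprod] bilinear_radd[OF bilinear_tprod]
    bilinear_lmul[OF bilinear_tprod] bilinear_rmul[OF bilinear_tprod]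
  have H: "subspace ?H"
    by (rule subspace_Lie_Hom) (rule linear_act)
  have T: "linear ?T"
    by (rule linearI) (auto simp: fun_eq_iff scaleR_fun_def ip_simps)
  have inj: "inj_on ?T ?H"
  proof (rule inj_onI)
    fix f g assume f: "f \<in> ?H" and g: "g \<in> ?H" and eq: "?T f = ?T g"
    have "f (x \<otimes>\<^sub>t y) = g (x \<otimes>\<^sub>t y)" for x y
      using eq by (intro ip_eqI) (simp add: fun_eq_iff)
    moreover have "linear f" "linear g"
      using f g by (simp_all add: Lie_Hom_def)
    ultimately show "f = g"
      by (metis ext linear_eq_on_tprod)
  qed
  have sub: "?T f \<in> invariant_forms \<gg> \<rho>" if f: "f \<in> ?H" for f
  proof -
    have lf: "linear f" using f by (simp add: Lie_Hom_def)
    have "trilinear (?T f)"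
      unfolding trilinear_def linear_iff
      by (simp add: bil linear_add[OF lf] linear_cmul[OF lf] ip_simps)
    moreover have "?T f (\<rho> X x) y z + ?T f x (\<rho> X y) z + ?T f x y (\<rho> X z) = 0" if X: "X \<in> \<gg>" for X x y z
    proof -
      have "f (\<rho> X x \<otimes>\<^sub>t y) + f (x \<otimes>\<^sub>t \<rho> X y) = f (tensor_act \<rho> \<rho> X (x \<otimes>\<^sub>t y))"
        by (simp add: tensor_act(2)[where \<rho>=\<rho> and \<sigma>=\<rho>, OF linear_act[OF X] linear_act[OF X]] linear_add[OF lf])
      also have "\<dots> = \<rho> X (f (x \<otimes>\<^sub>t y))"
        using f X by (simp add: Lie_Hom_def)
      finally have "ip (f (\<rho> X x \<otimes>\<^sub>t y) + f (x \<otimes>\<^sub>t \<rho> X y)) z = - ip (f (x \<otimes>\<^sub>t y)) (\<rho> X z)"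
        by (simp add: ip_act[OF X])
      then show ?thesis by (simp add: ip_simps)
    qed
    ultimately show ?thesis by (simp add: invariant_forms_def)
  qed
  have "F \<in> ?T ` ?H" if F: "F \<in> invariant_forms \<gg> \<rho>" for F
  proof -
    have tri: "trilinear F" using F by (simp add: invariant_forms_def)
    note lin = trilinearD[OF tri]
    \<comment> \<open>the vector that represents the linear form \<open>F x y\<close>\<close>
    let ?b = "\<lambda>x y. \<Sum>e\<in>E. F x y e *\<^sub>R e"
    have ipb: "ip (?b x y) z = F x y z" for x y z
      by (rule riesz[OF lin(3)])
    have "bilinear ?b"
      unfolding bilinear_def
      by (auto intro!: linearI simp: linear_add[OF lin(1)] linear_add[OF lin(2)]
          linear_cmul[OF lin(1)] linear_cmul[OF lin(2)] scaleR_add_left sum.distrib scaleR_sum_right)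
    from tensor_universal[OF this] obtain f
      where lf: "linear f" and f: "\<And>x y. f (x \<otimes>\<^sub>t y) = ?b x y" by blast
    have "f (tensor_act \<rho> \<rho> X t) = \<rho> X (f t)" if X: "X \<in> \<gg>" for X t
    proof (rule linear_eq_on_tprod[of "\<lambda>t. f (tensor_act \<rho> \<rho> X t)" "\<lambda>t. \<rho> X (f t)"])
      show "linear (\<lambda>t. f (tensor_act \<rho> \<rho> X t))"
        using linear_compose[OF tensor_act(1)[where \<rho>=\<rho> and \<sigma>=\<rho>, OF linear_act[OF X] linear_act[OF X]] lf] by (simp add: o_def)
      show "linear (\<lambda>t. \<rho> X (f t))"
        using linear_compose[OF lf linear_act[OF X]] by (simp add: o_def)
      fix x y
      show "f (tensor_act \<rho> \<rho> X (x \<otimes>\<^sub>t y)) = \<rho> X (f (x \<otimes>\<^sub>t y))"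
      proof (rule ip_eqI)
        fix z
        have "F (\<rho> X x) y z + F x (\<rho> X y) z + F x y (\<rho> X z) = 0"
          using F X by (simp add: invariant_forms_def)
        then show "ip (f (tensor_act \<rho> \<rho> X (x \<otimes>\<^sub>t y))) z = ip (\<rho> X (f (x \<otimes>\<^sub>t y))) z"
          by (simp add: tensor_act(2)[where \<rho>=\<rho> and \<sigma>=\<rho>, OF linear_act[OF X] linear_act[OF X]] linear_add[OF lf] f
              ip_act[OF X] ip_simps(1) ipb)
      qed
    qed
    with lf have "f \<in> ?H" by (simp add: Lie_Hom_def)
    moreover have "?T f = F" by (simp add: f ipb fun_eq_iff)
    ultimately show ?thesis by blast
  qed
  with sub have "?T ` ?H = invariant_forms \<gg> \<rho>" by blast
  with dim_image_inj_on[OF T H inj] show ?thesis by simp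
qed

text \<open>
  The inner product induced on the second exterior power, paired with \<open>y \<and> z\<close>: on \<open>a \<and> b\<close> it is
  the \<open>2 \<times> 2\<close> Gram determinant.
\<close>

definition minor :: "'a \<Rightarrow> 'a \<Rightarrow> (2 \<Rightarrow> 'a) \<Rightarrow> real" where
  "minor y z w = ip (w 1) y * ip (w 2) z - ip (w 1) z * ip (w 2) y"

definition ext2_pairing :: "'a \<Rightarrow> 'a \<Rightarrow> ('a, 2) ext_power \<Rightarrow> real" where
  "ext2_pairing y z = ext_lift (minor y z)"

lemma ext2_pairing:
  "linear (ext2_pairing y z)"
  "ext2_pairing y z (wedge (pair_family a b)) = ip a y * ip b z - ip a z * ip b y"
proof -
  have "multilinear (minor y z)"
    unfolding multilinear_pair bilinear_def linear_iff
    by (simp add: minor_def ip_simps algebra_simps)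
  moreover have "alternating (minor y z)"
    unfolding alternating_pair by (simp add: minor_def)
  ultimately have "linear (ext2_pairing y z) \<and> (\<forall>w. ext2_pairing y z (wedge w) = minor y z w)"
    unfolding ext2_pairing_def ext_lift_def by (rule theI'[OF ext_universal])
  then show "linear (ext2_pairing y z)"
    "ext2_pairing y z (wedge (pair_family a b)) = ip a y * ip b z - ip a z * ip b y"
    by (simp_all add: minor_def)
qed

lemma linear_eq_on_wedge_pair:
  fixes F G :: "('a, 2) ext_power \<Rightarrow> 'c::real_vector"
  assumes "linear F" "linear G" "\<And>a b. F (wedge (pair_family a b)) = G (wedge (pair_family a b))"
  shows "F t = G t"
  using assms by (metis linear_eq_on_wedge pair_family_eta)

lemma ext2_pairing_skew: "ext2_pairing y z t = - ext2_pairing z y t"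
  by (rule linear_eq_on_wedge_pair)
    (auto intro!: ext2_pairing(1) linear_compose_neg simp: ext2_pairing(2) algebra_simps)

lemma linear_ext2_pairing:
  "linear (\<lambda>y. ext2_pairing y z t)" "linear (\<lambda>z. ext2_pairing y z t)"
proof -
  note lin = linear_add[OF ext2_pairing(1)] linear_cmul[OF ext2_pairing(1)]
  have 1: "ext2_pairing (x + y) z t = ext2_pairing x z t + ext2_pairing y z t" for x y z t
    by (rule linear_eq_on_wedge_pair) (auto intro!: ext2_pairing(1) linear_compose_add
        simp: ext2_pairing(2) ip_simps algebra_simps)
  have 2: "ext2_pairing (c *\<^sub>R y) z t = c * ext2_pairing y z t" for c y z t
    by (rule linear_eq_on_wedge_pair)
      (auto intro!: ext2_pairing(1) linearI simp: lin ext2_pairing(2) ip_simps algebra_simps)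
  show "linear (\<lambda>y. ext2_pairing y z t)" by (rule linearI) (simp_all add: 1 2)
  show "linear (\<lambda>z. ext2_pairing y z t)" by (subst ext2_pairing_skew, rule linearI) (simp_all add: 1 2)
qed

lemma ext2_act_pair:
  assumes "X \<in> \<gg>"
  shows "ext_act \<rho> X (wedge (pair_family a b)) =
    wedge (pair_family (\<rho> X a) b) + wedge (pair_family a (\<rho> X b))"
  by (simp add: ext_act(2)[of \<rho> X, OF linear_act[OF assms]] sum_2)

lemma ext2_pairing_act:
  assumes X: "X \<in> \<gg>"
  shows "ext2_pairing y z (ext_act \<rho> X t) = - ext2_pairing (\<rho> X y) z t - ext2_pairing y (\<rho> X z) t"
proof (rule linear_eq_on_wedge_pair)
  show "linear (\<lambda>t. ext2_pairing y z (ext_act \<rho> X t))"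
    using linear_compose[OF ext_act(1)[of \<rho> X, OF linear_act[OF X]] ext2_pairing(1)] by (simp add: o_def)
  show "linear (\<lambda>t. - ext2_pairing (\<rho> X y) z t - ext2_pairing y (\<rho> X z) t)"
    by (intro linear_compose_sub linear_compose_neg ext2_pairing(1))
  show "ext2_pairing y z (ext_act \<rho> X (wedge (pair_family a b))) =
    - ext2_pairing (\<rho> X y) z (wedge (pair_family a b)) - ext2_pairing y (\<rho> X z) (wedge (pair_family a b))" for a b
    by (simp add: ext2_act_pair[OF X] linear_add[OF ext2_pairing(1)] ext2_pairing(2) ip_act[OF X] algebra_simps)
qed

lemma bilinear_wedge_pair: "bilinear (\<lambda>x y. wedge (pair_family x y))"
  by (rule multilinear_pair[THEN iffD1, OF multilinear_wedge])

lemma wedge_pair_skew: "wedge (pair_family a b) + wedge (pair_family b (a :: 'b::real_vector)) = 0"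
  using alternating_swap[OF multilinear_wedge alternating_wedge, of 1 2 "pair_family a a" a b] by simp

lemma expand_bilinear:
  assumes "bilinear g"
  shows "(\<Sum>d\<in>E. \<Sum>e\<in>E. (ip a d * ip b e) *\<^sub>R g d e) = g a b"
proof -
  have l1: "linear (\<lambda>x. g x y)" and l2: "linear (g x)" for x y
    using assms by (auto simp: bilinear_def)
  have "g a b = (\<Sum>d\<in>E. ip a d *\<^sub>R g d b)"
    by (subst expand[of a, symmetric]) (simp add: linear_sum[OF l1] linear_cmul[OF l1])
  also have "\<dots> = (\<Sum>d\<in>E. ip a d *\<^sub>R (\<Sum>e\<in>E. ip b e *\<^sub>R g d e))"
    by (subst (1) expand[of b, symmetric]) (simp add: linear_sum[OF l2] linear_cmul[OF l2])
  finally show ?thesis by (simp add: scaleR_sum_right)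
qed

text \<open>
  Each \<open>d \<and> e\<close> with \<open>d \<noteq> e\<close> occurs twice in the sum over ordered pairs, up to a sign that cancels,
  hence the factor \<open>1/2\<close>.
\<close>

lemma expand_ext2:
  "(1/2) *\<^sub>R (\<Sum>d\<in>E. \<Sum>e\<in>E. ext2_pairing d e t *\<^sub>R wedge (pair_family d e)) = t"
proof (rule linear_eq_on_wedge_pair[of "\<lambda>t. (1/2) *\<^sub>R (\<Sum>d\<in>E. \<Sum>e\<in>E. ext2_pairing d e t *\<^sub>R wedge (pair_family d e))" "\<lambda>t. t"])
  note lin = linear_add[OF ext2_pairing(1)] linear_cmul[OF ext2_pairing(1)]
  show "linear (\<lambda>t. (1/2) *\<^sub>R (\<Sum>d\<in>E. \<Sum>e\<in>E. ext2_pairing d e t *\<^sub>R wedge (pair_family d e)))"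
    by (rule linearI) (simp_all add: lin scaleR_add_left sum.distrib scaleR_add_right scaleR_sum_right mult.commute)
  show "linear (\<lambda>t. t)" by (rule linear_ident)
  fix a b
  let ?W = "\<lambda>a b. wedge (pair_family a b)"
  have "(\<Sum>d\<in>E. \<Sum>e\<in>E. ext2_pairing d e (?W a b) *\<^sub>R ?W d e)
      = (\<Sum>d\<in>E. \<Sum>e\<in>E. (ip a d * ip b e) *\<^sub>R ?W d e) - (\<Sum>d\<in>E. \<Sum>e\<in>E. (ip b d * ip a e) *\<^sub>R ?W d e)"
    by (simp add: ext2_pairing(2) scaleR_diff_left sum_subtractf mult.commute)
  also have "\<dots> = ?W a b - ?W b a"
    by (simp add: expand_bilinear[OF bilinear_wedge_pair])
  also have "\<dots> = 2 *\<^sub>R ?W a b"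
    using wedge_pair_skew[of a b] by (simp add: scaleR_2 eq_neg_iff_add_eq_0[symmetric] algebra_simps)
  finally show "(1/2) *\<^sub>R (\<Sum>d\<in>E. \<Sum>e\<in>E. ext2_pairing d e (?W a b) *\<^sub>R ?W d e) = ?W a b"
    by simp
qed

lemma ext2_eqI:
  assumes "\<And>y z. ext2_pairing y z s = ext2_pairing y z t"
  shows "s = t"
  by (subst (1 2) expand_ext2[symmetric]) (simp only: assms)

text \<open>
  The isomorphism sends \<open>f\<close> to \<open>\<langle>f x, y \<and> z\<rangle>\<close>. The inverse expands in the vectors \<open>d \<and> e\<close> with
  \<open>d, e \<in> E\<close>, as in the expansion of the second exterior power.
\<close>

lemma dim_Hom_ext2:
  "dim (Lie_Hom \<gg> \<rho> (ext_act \<rho>) :: ('a \<Rightarrow> ('a, 2) ext_power) set) =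
   dim {F \<in> invariant_forms \<gg> \<rho>. \<forall>x y z. F x z y = - F x y z}"
proof -
  let ?H = "Lie_Hom \<gg> \<rho> (ext_act \<rho>) :: ('a \<Rightarrow> ('a, 2) ext_power) set"
  let ?I = "{F \<in> invariant_forms \<gg> \<rho>. \<forall>x y z. F x z y = - F x y z}"
  let ?T = "\<lambda>(f :: 'a \<Rightarrow> ('a, 2) ext_power) x y z. ext2_pairing y z (f x)"
  have H: "subspace ?H"
    by (rule subspace_Lie_Hom) (rule ext_act(1)[OF linear_act])
  have T: "linear ?T"
    by (rule linearI) (auto simp: fun_eq_iff scaleR_fun_def linear_add[OF ext2_pairing(1)]
        linear_cmul[OF ext2_pairing(1)])
  have inj: "inj_on ?T ?H"
  proof (rule inj_onI)
    fix f g assume eq: "?T f = ?T g"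
    show "f = g"
    proof
      fix x show "f x = g x"
        using eq by (intro ext2_eqI) (simp add: fun_eq_iff)
    qed
  qed
  have sub: "?T f \<in> ?I" if f: "f \<in> ?H" for f
  proof -
    have lf: "linear f" using f by (simp add: Lie_Hom_def)
    have "linear (\<lambda>x. ext2_pairing y z (f x))" for y z
      using linear_compose[OF lf ext2_pairing(1)] by (simp add: o_def)
    then have "trilinear (?T f)"
      by (simp add: trilinear_def linear_ext2_pairing)
    moreover have "?T f (\<rho> X x) y z + ?T f x (\<rho> X y) z + ?T f x y (\<rho> X z) = 0" if X: "X \<in> \<gg>" for X x y z
      using f X by (simp add: Lie_Hom_def ext2_pairing_act)
    moreover have "?T f x z y = - ?T f x y z" for x y z
      by (rule ext2_pairing_skew)
    ultimately show ?thesis unfolding invariant_forms_def by blast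
  qed
  have "F \<in> ?T ` ?H" if F: "F \<in> ?I" for F
  proof -
    have tri: "trilinear F" using F by (simp add: invariant_forms_def)
    have skew: "F x z y = - F x y z" for x y z using F by blast
    note lin = trilinearD[OF tri]
    let ?f = "\<lambda>x. (1/2) *\<^sub>R (\<Sum>d\<in>E. \<Sum>e\<in>E. F x d e *\<^sub>R wedge (pair_family d e)) :: ('a, 2) ext_power"
    have Tf: "?T ?f x y z = F x y z" for x y z
    proof -
      have bil: "bilinear (F x)" using lin by (simp add: bilinear_def)
      have "ext2_pairing y z (\<Sum>d\<in>E. \<Sum>e\<in>E. F x d e *\<^sub>R wedge (pair_family d e))
        = (\<Sum>d\<in>E. \<Sum>e\<in>E. (ip y d * ip z e) *\<^sub>R F x d e) - (\<Sum>d\<in>E. \<Sum>e\<in>E. (ip z d * ip y e) *\<^sub>R F x d e)"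
        by (simp add: linear_sum[OF ext2_pairing(1)] linear_cmul[OF ext2_pairing(1)] ext2_pairing(2)
            ip_sym[of _ y] ip_sym[of _ z] sum_subtractf[symmetric] algebra_simps)
      also have "\<dots> = 2 * F x y z"
        unfolding expand_bilinear[OF bil] using skew[of x z y] by simp
      finally show ?thesis by (simp add: linear_cmul[OF ext2_pairing(1)])
    qed
    have lf: "linear ?f"
      by (rule linearI) (simp_all add: linear_add[OF lin(1)] linear_cmul[OF lin(1)] scaleR_add_left
          sum.distrib scaleR_add_right scaleR_sum_right mult.commute mult.left_commute)
    have "?f (\<rho> X x) = ext_act \<rho> X (?f x)" if X: "X \<in> \<gg>" for X x
    proof (rule ext2_eqI)
      fix y z
      have "F (\<rho> X x) y z + F x (\<rho> X y) z + F x y (\<rho> X z) = 0"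
        using F X unfolding invariant_forms_def by blast
      then show "ext2_pairing y z (?f (\<rho> X x)) = ext2_pairing y z (ext_act \<rho> X (?f x))"
        unfolding ext2_pairing_act[OF X] Tf by simp
    qed
    with lf have "?f \<in> ?H" unfolding Lie_Hom_def by blast
    moreover have "F = ?T ?f" by (intro ext) (rule Tf[symmetric])
    ultimately show ?thesis by (intro image_eqI[of F ?T ?f ?H])
  qed
  with sub have "?T ` ?H = ?I" by blast
  with dim_image_inj_on[OF T H inj] show ?thesis by simp
qed

text \<open>
  By the universal property, linear forms on the third exterior power are the alternating trilinear
  forms; such a form is a homomorphism into the trivial module iff it is annihilated by \<open>\<gg>\<close>, that is,
  invariant. The two transpositions in the condition generate all permutations of the arguments.
\<close>

lemma dim_Hom_ext3:
  "dim (Lie_Hom \<gg> (ext_act \<rho>) trivial_act :: (('a, 3) ext_power \<Rightarrow> real) set) =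
   dim {F \<in> invariant_forms \<gg> \<rho>. \<forall>x y z. F x z y = - F x y z \<and> F y x z = - F x y z}"
proof -
  let ?H = "Lie_Hom \<gg> (ext_act \<rho>) trivial_act :: (('a, 3) ext_power \<Rightarrow> real) set"
  let ?I = "{F \<in> invariant_forms \<gg> \<rho>. \<forall>x y z. F x z y = - F x y z \<and> F y x z = - F x y z}"
  let ?W = "\<lambda>x y z :: 'a. wedge (triple_family x y z)"
  let ?T = "\<lambda>(f :: ('a, 3) ext_power \<Rightarrow> real) x y z. f (?W x y z)"
  have act: "ext_act \<rho> X (?W x y z) = ?W (\<rho> X x) y z + ?W x (\<rho> X y) z + ?W x y (\<rho> X z)"
    if "X \<in> \<gg>" for X x y z
    by (simp add: ext_act(2)[of \<rho> X, OF linear_act[OF that]] sum_3)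
  have eqI: "f t = g t" if "linear f" "linear g" "?T f = ?T g" for f g :: "('a, 3) ext_power \<Rightarrow> real" and t
  proof (rule linear_eq_on_wedge[OF that(1,2)])
    fix w :: "3 \<Rightarrow> 'a"
    show "f (wedge w) = g (wedge w)"
      using that(3) by (subst (1 2) triple_family_eta) (simp add: fun_eq_iff)
  qed
  have H: "subspace ?H"
    by (rule subspace_Lie_Hom) (simp add: trivial_act_def linear_iff)
  have T: "linear ?T"
    by (rule linearI) (auto simp: fun_eq_iff scaleR_fun_def)
  have inj: "inj_on ?T ?H"
    by (rule inj_onI, rule ext, rule eqI) (auto simp: Lie_Hom_def)
  have sub: "?T f \<in> ?I" if f: "f \<in> ?H" for f
  proof -
    have lf: "linear f" using f by (simp add: Lie_Hom_def)
    have tri: "trilinear ?W"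
      by (rule multilinear_triple[THEN iffD1, OF multilinear_wedge])
    note trl = trilinearD[OF tri]
    have "trilinear (?T f)"
      unfolding trilinear_def using trl linear_compose[OF _ lf, unfolded o_def] by blast
    moreover have "?T f (\<rho> X x) y z + ?T f x (\<rho> X y) z + ?T f x y (\<rho> X z) = 0" if X: "X \<in> \<gg>" for X x y z
    proof -
      have "f (ext_act \<rho> X (?W x y z)) = 0"
        using f X by (simp add: Lie_Hom_def trivial_act_def)
      then show ?thesis by (simp add: act[OF X] linear_add[OF lf])
    qed
    moreover have "?T f x z y = - ?T f x y z \<and> ?T f y x z = - ?T f x y z" for x y z
    proof -
      have "?W x y z + ?W x z y = 0" "?W x y z + ?W y x z = 0"
        using alternating_swap[OF multilinear_wedge alternating_wedge, of 2 3 "triple_family x x x" y z]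
          alternating_swap[OF multilinear_wedge alternating_wedge, of 1 2 "triple_family z z z" x y]
        by simp_all
      then have "f (?W x y z) + f (?W x z y) = 0" "f (?W x y z) + f (?W y x z) = 0"
        by (simp_all add: linear_add[OF lf, symmetric] linear_0[OF lf])
      then show ?thesis by simp
    qed
    ultimately show ?thesis unfolding invariant_forms_def by blast
  qed
  have "F \<in> ?T ` ?H" if F: "F \<in> ?I" for F
  proof -
    have tri: "trilinear F" using F by (simp add: invariant_forms_def)
    have skew: "F x z y = - F x y z" "F y x z = - F x y z" for x y z using F by blast+
    let ?g = "\<lambda>w :: 3 \<Rightarrow> 'a. F (w 1) (w 2) (w 3)"
    have "multilinear ?g" using tri by (simp add: multilinear_triple)
    moreover have "alternating ?g"
      unfolding alternating_triple
    proof (intro allI conjI)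
      fix x y
      have "F x x y = 0" using skew(2)[of x x y] by simp
      moreover have "F y x x = 0" using skew(1)[of y x x] by simp
      moreover have "F x y x = - F y x x" by (rule skew(2))
      ultimately show "?g (triple_family x x y) = 0" "?g (triple_family x y x) = 0" "?g (triple_family y x x) = 0"
        by simp_all
    qed
    ultimately obtain f where lf: "linear f" and f: "\<And>w. f (wedge w) = ?g w"
      using ext_universal by blast
    have Tf: "?T f = F" by (simp add: f fun_eq_iff)
    have "f (ext_act \<rho> X t) = 0" if X: "X \<in> \<gg>" for X t
    proof (rule eqI[of "\<lambda>t. f (ext_act \<rho> X t)" "\<lambda>t. 0"])
      show "linear (\<lambda>t. f (ext_act \<rho> X t))"
        using linear_compose[OF ext_act(1)[of \<rho> X, OF linear_act[OF X]] lf] by (simp add: o_def)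
      have "F (\<rho> X x) y z + F x (\<rho> X y) z + F x y (\<rho> X z) = 0" for x y z
        using F X unfolding invariant_forms_def by blast
      then show "(\<lambda>x y z. f (ext_act \<rho> X (?W x y z))) = (\<lambda>x y z. 0)"
        by (simp add: act[OF X] linear_add[OF lf] f fun_eq_iff)
    qed (simp add: linear_iff)
    with lf have "f \<in> ?H" by (simp add: Lie_Hom_def trivial_act_def)
    with Tf show ?thesis by blast
  qed
  with sub have "?T ` ?H = ?I" by blast
  with dim_image_inj_on[OF T H inj] show ?thesis by simp
qed

end

section \<open>Invariants of the standard representation\<close>

text \<open>
  Real inner products on \<open>\<complex>\<close> and \<open>\<complex>\<^sup>n\<close> are the real parts of the Hermitian ones; this ties the
  invariant Hermitian form to the Euclidean structure.
\<close>

lemma inner_complex_Re: "inner (a::complex) b = Re (a * cnj b)"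
  by (simp add: inner_complex_def)

lemma scalar_mult_scaleR:
  "(r *\<^sub>R c) *s (x :: complex ^ 'n) = r *\<^sub>R (c *s x)" "c *s (r *\<^sub>R x) = r *\<^sub>R (c *s x)"
  by (simp_all add: vec_eq_iff scaleR_conv_of_real[where 'a = complex])

lemma scalar_mult_add:
  "(c + d) *s (x :: complex ^ 'n) = c *s x + d *s x" "c *s (x + y) = c *s x + c *s y"
  by (simp_all add: vec_eq_iff algebra_simps)

lemma inner_scalar_mult: "inner (c *s x) (y :: complex ^ 'n) = inner x (cnj c *s y)"
  by (simp add: inner_vec_def inner_complex_Re mult_ac)

lemma inner_u:
  fixes x y :: "complex ^ 'n::finite"
  assumes "B \<in> \<uu>"
  shows "inner (B *v x) y = - inner x (B *v y)"
proof -
  have "inner (B *v x) y = Re (\<Sum>i\<in>UNIV. \<Sum>j\<in>UNIV. B $ i $ j * x $ j * cnj (y $ i))"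
    by (simp add: inner_vec_def inner_complex_Re matrix_vector_mult_def sum_distrib_right)
  also have "(\<Sum>i\<in>UNIV. \<Sum>j\<in>UNIV. B $ i $ j * x $ j * cnj (y $ i)) =
      (\<Sum>j\<in>UNIV. \<Sum>i\<in>UNIV. B $ i $ j * x $ j * cnj (y $ i))"
    by (rule sum.swap)
  also have "\<dots> = - (\<Sum>j\<in>UNIV. x $ j * cnj ((B *v y) $ j))"
    by (simp add: matrix_vector_mult_def u_entry[OF assms] sum_negf sum_distrib_left mult_ac)
  also have "Re \<dots> = - inner x (B *v y)"
    by (simp add: inner_vec_def inner_complex_Re)
  finally show ?thesis .
qed

lemma matrix_vector_mult_scalar: "B *v (c *s x) = c *s (B *v (x :: complex ^ 'n::finite))"
  by (simp add: vec_eq_iff matrix_vector_mult_def sum_distrib_left mult_ac)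

lemma mat_vector_mult: "mat c *v (x :: complex ^ 'n::finite) = c *s x"
proof -
  have "(\<Sum>j\<in>UNIV. (if i = j then c else 0) * x $ j) = (\<Sum>j\<in>UNIV. if i = j then c * x $ j else 0)" for i
    by (rule sum.cong) auto
  then show ?thesis
    by (simp add: matrix_vector_mult_def mat_def vec_eq_iff)
qed

lemma mat_i: "mat \<i> \<in> (\<uu> :: (complex ^ 'n::finite ^ 'n) set)"
  by (auto simp: unitary_algebra_def cadjoint_def mat_def vec_eq_iff)

text \<open>
  The matrix \<open>i w w\<^sup>*\<close>. These elements of \<open>\<uu>(n)\<close> detect the Hermitian product with \<open>w\<close>, which is
  what makes the commutant small.
\<close>

definition skew_rank_one :: "complex ^ 'n \<Rightarrow> complex ^ 'n ^ 'n" where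
  "skew_rank_one w = (\<chi> k l. \<i> * w $ k * cnj (w $ l))"

lemma skew_rank_one:
  "skew_rank_one w \<in> \<uu>"
  "skew_rank_one w *v x = (\<i> * (\<Sum>l\<in>UNIV. cnj (w $ l) * x $ l)) *s w"
  by (auto simp: skew_rank_one_def unitary_algebra_def cadjoint_def vec_eq_iff matrix_vector_mult_def
      sum_distrib_left mult_ac)

text \<open>
  Commuting with \<open>i I\<close> makes \<open>f\<close> complex linear. Commuting with \<open>i w w\<^sup>*\<close> gives
  \<open>\<langle>w, z\<rangle> f w = \<langle>w, f z\<rangle> w\<close> for all \<open>z\<close>. For \<open>z = w = e\<close> a unit vector this reads \<open>f e = c e\<close>, and then
  for \<open>z = e\<close> it gives \<open>f w = c w\<close> for all \<open>w\<close> that are not orthogonal to \<open>e\<close>; adding \<open>e\<close> to \<open>w\<close>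
  takes care of the others.
\<close>

lemma u_commutant_scalar:
  fixes f :: "complex ^ 'n::finite \<Rightarrow> complex ^ 'n"
  assumes f: "linear f" and comm: "\<And>B x. B \<in> \<uu> \<Longrightarrow> f (B *v x) = B *v f x"
  shows "\<exists>c. \<forall>x. f x = c *s x"
proof -
  let ?h = "\<lambda>w x :: complex ^ 'n. \<Sum>l\<in>UNIV. cnj (w $ l) * x $ l"
  have fi: "f (\<i> *s x) = \<i> *s f x" for x
    using comm[OF mat_i] by (simp add: mat_vector_mult)
  have fc: "f (c *s x) = c *s f x" for c x
  proof -
    have c: "c = Re c *\<^sub>R 1 + Im c *\<^sub>R \<i>" by (simp add: complex_eq_iff)
    show ?thesis
      by (subst (1 2) c) (simp add: scalar_mult_add(1) scalar_mult_scaleR(1) linear_add[OF f]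
          linear_cmul[OF f] fi del: scaleR_complex.simps)
  qed
  have rank_one: "?h w z *s f w = ?h w (f z) *s w" for w z
  proof -
    have "(\<i> * ?h w z) *s f w = (\<i> * ?h w (f z)) *s w"
      using comm[OF skew_rank_one(1)[of w], of z] by (simp only: skew_rank_one(2) fc)
    then show ?thesis by (simp add: vec_eq_iff)
  qed
  \<comment> \<open>\<open>undefined\<close> serves as an arbitrary index: any basis vector would do.\<close>
  define e :: "complex ^ 'n" where "e = axis undefined 1"
  define c where "c = ?h e (f e)"
  have he: "?h w e = cnj (w $ undefined)" for w
    by (simp add: e_def axis_def if_distrib cong: if_cong)
  have fe: "f e = c *s e"
    using rank_one[of e e] by (simp add: he c_def[symmetric]) (simp add: e_def)
  have hc: "?h w (c *s e) = c * ?h w e" for w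
    by (simp add: sum_distrib_left mult_ac)
  have nonorth: "f w = c *s w" if "w $ undefined \<noteq> 0" for w
    using rank_one[of w e] that unfolding fe hc by (simp add: he vec_eq_iff)
  have "f x = c *s x" for x
  proof (cases "x $ undefined = 0")
    case True
    then have "f (x + e) = c *s (x + e)"
      by (intro nonorth) (simp add: e_def)
    then show ?thesis by (simp add: linear_add[OF f] fe scalar_mult_add)
  qed (rule nonorth)
  then show ?thesis by blast
qed

text \<open>
  An invariant bilinear form is \<open>\<langle>f x, y\<rangle>\<close> for an operator \<open>f\<close> that commutes with \<open>\<uu>(n)\<close>.
\<close>

lemma u_invariant_bilinear_form:
  fixes b :: "complex ^ 'n::finite \<Rightarrow> complex ^ 'n \<Rightarrow> real"
  assumes b: "bilinear b" and inv: "\<And>B x y. B \<in> \<uu> \<Longrightarrow> b (B *v x) y + b x (B *v y) = 0"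
  shows "\<exists>c. \<forall>x y. b x y = inner (c *s x) y"
proof -
  let ?f = "\<lambda>x. \<Sum>e\<in>Basis. b x e *\<^sub>R e"
  have l1: "linear (\<lambda>x. b x y)" and l2: "linear (b x)" for x y
    using b by (auto simp: bilinear_def)
  have bf: "inner (?f x) y = b x y" for x y
  proof -
    have "b x y = b x (\<Sum>e\<in>Basis. inner y e *\<^sub>R e)" by (simp only: euclidean_representation)
    also have "\<dots> = (\<Sum>e\<in>Basis. b x e * inner e y)"
      by (simp only: linear_sum[OF l2] linear_cmul[OF l2]) (simp add: inner_commute mult.commute)
    finally show ?thesis by (simp add: inner_sum_left)
  qed
  have f: "linear ?f"
    by (rule linearI) (simp_all add: linear_add[OF l1] linear_cmul[OF l1] scaleR_add_left sum.distrib scaleR_sum_right)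
  have "?f (B *v x) = B *v ?f x" if B: "B \<in> \<uu>" for B x
  proof (rule vector_eq_rdot[THEN iffD1], rule allI)
    fix y
    have "b (B *v x) y = - b x (B *v y)" using inv[OF B, of x y] by simp
    then show "inner (?f (B *v x)) y = inner (B *v ?f x) y"
      unfolding inner_u[OF B] bf .
  qed
  from u_commutant_scalar[OF f this] obtain c where "\<And>x. ?f x = c *s x" by blast
  then show ?thesis using bf by metis
qed

section \<open>Two copies of the standard representation\<close>

definition pair_form :: "complex ^ 2 ^ 2 \<Rightarrow> (complex ^ 'n::finite) ^ 2 \<Rightarrow> (complex ^ 'n) ^ 2 \<Rightarrow> real" where
  "pair_form C u v = (\<Sum>p\<in>UNIV. \<Sum>q\<in>UNIV. inner (C $ p $ q *s u $ p) (v $ q))"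

definition diag_act :: "complex ^ 'n ^ 'n \<Rightarrow> (complex ^ 'n::finite) ^ 2 \<Rightarrow> (complex ^ 'n) ^ 2" where
  "diag_act B u = (\<chi> p. B *v u $ p)"

lemma bilinear_pair_form: "bilinear (pair_form C)"
  unfolding bilinear_def linear_iff
  by (simp add: pair_form_def scalar_mult_add scalar_mult_scaleR inner_add_left inner_add_right sum_2 algebra_simps)

lemma pair_form_invariant:
  fixes B :: "complex ^ 'n::finite ^ 'n"
  assumes "B \<in> \<uu>"
  shows "pair_form C (diag_act B u) v + pair_form C u (diag_act B v) = 0"
proof -
  have "inner (c *s (B *v x)) y = - inner (c *s x) (B *v y)" for c and x y :: "complex ^ 'n"
    by (simp add: inner_u[OF assms] flip: matrix_vector_mult_scalar)
  then show ?thesis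
    by (simp add: pair_form_def diag_act_def sum_2)
qed

lemma pair_form_linear_in_matrix:
  "pair_form (C + D) u v = pair_form C u v + pair_form D u v"
  "pair_form (r *\<^sub>R C) u v = r * pair_form C u v"
  by (simp_all add: pair_form_def scalar_mult_add scalar_mult_scaleR inner_add_left sum_2 algebra_simps)

lemma pair_form_axis: "pair_form C (axis p x) (axis q y) = inner (C $ p $ q *s x) y"
  using exhaust_2[of p] exhaust_2[of q] by (auto simp: pair_form_def sum_2 axis_def)

text \<open>
  For \<open>x\<close> a basis vector in the \<open>p\<close>-th summand and its multiple by \<open>C $ p $ q\<close> in the \<open>q\<close>-th one, the
  form takes the value \<open>|C $ p $ q|\<^sup>2\<close>.
\<close>

lemma pair_form_eq_0:
  assumes "\<And>u v :: (complex ^ 'n::finite) ^ 2. pair_form C u v = 0"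
  shows "C = 0"
proof -
  have "C $ p $ q = 0" for p q
  proof -
    define x :: "complex ^ 'n" where "x = axis undefined 1"
    have "inner (C $ p $ q *s x) (C $ p $ q *s x) = 0"
      using assms[of "axis p x" "axis q (C $ p $ q *s x)"] by (simp only: pair_form_axis)
    then have "(C $ p $ q *s x) $ undefined = 0"
      by (simp only: inner_eq_zero_iff) simp
    then show ?thesis by (simp add: x_def)
  qed
  then show ?thesis by (simp add: vec_eq_iff)
qed

lemma vec2_decomp: "u = axis 1 (u $ 1) + axis (2::2) (u $ 2)" for u :: "'a::real_vector ^ 2"
  by (simp add: vec_eq_iff axis_def forall_2)

lemma diag_act_axis: "diag_act B (axis p x) = axis p (B *v x)"
  by (simp add: diag_act_def vec_eq_iff axis_def)

lemma linear_axis: "linear (axis p :: 'a::real_vector \<Rightarrow> 'a ^ 'm)"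
  by (rule linearI) (auto simp: vec_eq_iff axis_def)

lemma invariant_bilinear_pair_form:
  fixes b :: "(complex ^ 'n::finite) ^ 2 \<Rightarrow> (complex ^ 'n) ^ 2 \<Rightarrow> real"
  assumes b: "bilinear b" and inv: "\<And>B u v. B \<in> \<uu> \<Longrightarrow> b (diag_act B u) v + b u (diag_act B v) = 0"
  shows "\<exists>C. b = pair_form C"
proof -
  have l1: "linear (\<lambda>x. b x y)" and l2: "linear (b x)" for x y
    using b by (auto simp: bilinear_def)
  have "\<exists>c. \<forall>x y. b (axis p x) (axis q y) = inner (c *s x) y" for p q
  proof (rule u_invariant_bilinear_form)
    show "bilinear (\<lambda>x y. b (axis p x) (axis q y))"
      unfolding bilinear_def
      using linear_compose[OF linear_axis l1] linear_compose[OF linear_axis l2] by (simp add: o_def)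
    show "b (axis p (B *v x)) (axis q y) + b (axis p x) (axis q (B *v y)) = 0" if "B \<in> \<uu>" for B x y
      using inv[OF that, of "axis p x" "axis q y"] by (simp add: diag_act_axis)
  qed
  then obtain c where c: "\<And>p q x y. b (axis p x) (axis q y) = inner (c p q *s x) y" by metis
  have "b u v = pair_form (\<chi> p q. c p q) u v" for u v
    by (subst vec2_decomp[of u], subst vec2_decomp[of v])
      (simp add: linear_add[OF l1] linear_add[OF l2] c pair_form_def sum_2)
  then show ?thesis by blast
qed

lemma i_twice: "diag_act (mat \<i>) (diag_act (mat \<i>) u) = - u"
  by (simp add: diag_act_def mat_vector_mult vec_eq_iff flip: mult.assoc)

lemma invariant_linear_form_0:
  fixes g :: "(complex ^ 'n::finite) ^ 2 \<Rightarrow> real"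
  assumes g: "linear g" and inv: "\<And>u. g (diag_act (mat \<i>) u) = 0"
  shows "g u = 0"
  using inv[of "diag_act (mat \<i>) u"] by (simp add: i_twice linear_neg[OF g])

text \<open>
  Let \<open>J\<^sub>1, J\<^sub>2, J\<^sub>3\<close> be multiplication by \<open>i\<close> in the three arguments. Invariance under \<open>i I\<close> says that
  \<open>J\<^sub>1 + J\<^sub>2 + J\<^sub>3\<close> kills \<open>g\<close>, so \<open>(J\<^sub>1 + J\<^sub>2)\<^sup>2 g = J\<^sub>3\<^sup>2 g = - g\<close>, that is, \<open>2 J\<^sub>1 J\<^sub>2 g = g\<close>. Squaring,
  \<open>4 g = g\<close>.
\<close>

lemma invariant_trilinear_form_0:
  fixes g :: "(complex ^ 'n::finite) ^ 2 \<Rightarrow> (complex ^ 'n) ^ 2 \<Rightarrow> (complex ^ 'n) ^ 2 \<Rightarrow> real"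
  assumes g: "trilinear g"
    and inv: "\<And>u v w. g (diag_act (mat \<i>) u) v w + g u (diag_act (mat \<i>) v) w + g u v (diag_act (mat \<i>) w) = 0"
  shows "g u v w = 0"
proof -
  let ?J = "diag_act (mat \<i>) :: (complex ^ 'n) ^ 2 \<Rightarrow> _"
  note lin = trilinearD[OF g]
  note neg = linear_neg[OF lin(1)] linear_neg[OF lin(2)] linear_neg[OF lin(3)]
  have half: "2 * g (?J u) (?J v) w = g u v w" for u v w
    using inv[of "?J u" v w] inv[of u "?J v" w] inv[of u v "?J w"]
    by (simp add: i_twice neg)
  have "g u v w = 2 * g (?J u) (?J v) w" by (simp add: half)
  also have "\<dots> = 4 * g (?J (?J u)) (?J (?J v)) w" using half[of "?J u" "?J v" w] by simp
  also have "\<dots> = 4 * g u v w" by (simp add: i_twice neg)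
  finally show ?thesis by simp
qed

section \<open>Invariant trilinear forms\<close>

type_synonym 'n coords = "(real ^ 3) \<times> ((complex ^ 'n) ^ 2)"

definition coord_act :: "complex ^ 'n ^ 'n \<Rightarrow> 'n::finite coords \<Rightarrow> 'n coords" where
  "coord_act B x = (0, diag_act B (snd x))"

text \<open>
  The general invariant trilinear form. The matrices \<open>P\<close>, \<open>Q\<close>, \<open>R\<close> belong to the terms where the
  argument from \<open>\<real>\<^sup>3\<close> is the first, the second and the third one.
\<close>

definition coord_form :: "real ^ 3 ^ 3 ^ 3 \<Rightarrow> complex ^ 2 ^ 2 ^ 3 \<Rightarrow> complex ^ 2 ^ 2 ^ 3 \<Rightarrow> complex ^ 2 ^ 2 ^ 3 \<Rightarrow>
    'n::finite coords \<Rightarrow> 'n coords \<Rightarrow> 'n coords \<Rightarrow> real" where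
  "coord_form A P Q R x y z =
     (\<Sum>a\<in>UNIV. \<Sum>b\<in>UNIV. \<Sum>c\<in>UNIV. A $ a $ b $ c * fst x $ a * fst y $ b * fst z $ c) +
     (\<Sum>a\<in>UNIV. fst x $ a * pair_form (P $ a) (snd y) (snd z)) +
     (\<Sum>a\<in>UNIV. fst y $ a * pair_form (Q $ a) (snd x) (snd z)) +
     (\<Sum>a\<in>UNIV. fst z $ a * pair_form (R $ a) (snd x) (snd y))"

lemma pair_form_lin: 
  "pair_form C (u + u') v = pair_form C u v + pair_form C u' v"
  "pair_form C u (v + v') = pair_form C u v + pair_form C u v'"
  "pair_form C (r *\<^sub>R u) v = r * pair_form C u v"
  "pair_form C u (r *\<^sub>R v) = r * pair_form C u v"
  "pair_form C 0 v = 0" "pair_form C u 0 = 0"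
  using bilinear_ladd[OF bilinear_pair_form] bilinear_radd[OF bilinear_pair_form]
    bilinear_lmul[OF bilinear_pair_form] bilinear_rmul[OF bilinear_pair_form]
    bilinear_lzero[OF bilinear_pair_form] bilinear_rzero[OF bilinear_pair_form] by auto

lemma trilinear_coord_form: "trilinear (coord_form A P Q R)"
  unfolding trilinear_def linear_iff
  by (simp add: coord_form_def pair_form_lin ring_distribs sum.distrib sum_distrib_left mult_ac)

lemma coord_form_invariant:
  fixes B :: "complex ^ 'n::finite ^ 'n"
  assumes "B \<in> \<uu>"
  shows "coord_form A P Q R (coord_act B x) y z + coord_form A P Q R x (coord_act B y) z + coord_form A P Q R x y (coord_act B z) = 0"
proof -
  have *: "pair_form C u (diag_act B v) = - pair_form C (diag_act B u) v" for C and u v :: "(complex ^ 'n) ^ 2"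
    using pair_form_invariant[OF assms, of C u v] by simp
  show ?thesis by (simp add: coord_form_def coord_act_def * sum_negf)
qed

lemma coord_form_values:
  "coord_form A P Q R (t, 0) (s, 0) (r, 0) = (\<Sum>a\<in>UNIV. \<Sum>b\<in>UNIV. \<Sum>c\<in>UNIV. A $ a $ b $ c * t $ a * s $ b * r $ c)"
  "coord_form A P Q R (t, 0) (0, v) (0, w) = (\<Sum>a\<in>UNIV. t $ a * pair_form (P $ a) v w)"
  "coord_form A P Q R (0, u) (s, 0) (0, w) = (\<Sum>a\<in>UNIV. s $ a * pair_form (Q $ a) u w)"
  "coord_form A P Q R (0, u) (0, v) (r, 0) = (\<Sum>a\<in>UNIV. r $ a * pair_form (R $ a) u v)"
  by (simp_all add: coord_form_def pair_form_lin)

lemma sum_axis: "(\<Sum>a\<in>UNIV. axis b 1 $ a * f a) = (f b :: real)" "(\<Sum>a\<in>UNIV. f a * axis b 1 $ a) = f b"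
proof -
  have "(\<Sum>a\<in>UNIV. axis b 1 $ a * f a) = (\<Sum>a\<in>UNIV. if a = b then f a else 0)"
    by (rule sum.cong) (auto simp: axis_def)
  then show "(\<Sum>a\<in>UNIV. axis b 1 $ a * f a) = f b" by simp
  then show "(\<Sum>a\<in>UNIV. f a * axis b 1 $ a) = f b" by (simp add: mult.commute)
qed

lemma coord_form_values_axis:
  "coord_form A P Q R (axis a 1, 0) (axis b 1, 0) (axis c 1, 0) = A $ a $ b $ c"
  "coord_form A P Q R (axis a 1, 0) (0, v) (0, w) = pair_form (P $ a) v w"
  "coord_form A P Q R (0, u) (axis a 1, 0) (0, w) = pair_form (Q $ a) u w"
  "coord_form A P Q R (0, u) (0, v) (axis a 1, 0) = pair_form (R $ a) u v"
  by (simp_all add: coord_form_values sum_axis)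

lemma linear_real3: 
  fixes g :: "real ^ 3 \<Rightarrow> real"
  assumes "linear g"
  shows "g t = (\<Sum>a\<in>UNIV. t $ a * g (axis a 1))"
proof -
  have "t = (\<Sum>a\<in>UNIV. t $ a *\<^sub>R axis a 1)"
    using basis_expansion[of t] by (simp add: scalar_mult_eq_scaleR)
  then have "g t = g (\<Sum>a\<in>UNIV. t $ a *\<^sub>R axis a 1)" by simp
  then show ?thesis by (simp add: linear_sum[OF assms] linear_cmul[OF assms])
qed

text \<open>
  By trilinearity a form is determined by its values on arguments that lie in \<open>\<real>\<^sup>3\<close> or in \<open>V\<^sup>2\<close>. Of the
  eight kinds of such arguments, invariance under \<open>i I\<close> removes those with one or three entries in
  \<open>V\<^sup>2\<close>, and the remaining ones are covered by \<open>A\<close>, \<open>P\<close>, \<open>Q\<close> and \<open>R\<close>.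
\<close>

lemma invariant_is_coord_form:
  fixes F :: "'n::finite coords \<Rightarrow> 'n coords \<Rightarrow> 'n coords \<Rightarrow> real"
  assumes F: "trilinear F"
    and inv: "\<And>B x y z. B \<in> \<uu> \<Longrightarrow> F (coord_act B x) y z + F x (coord_act B y) z + F x y (coord_act B z) = 0"
  shows "\<exists>A P Q R. F = coord_form A P Q R"
proof -
  note lin = trilinearD[OF F]
  note zero = linear_0[OF lin(1)] linear_0[OF lin(2)] linear_0[OF lin(3)]
  note add = linear_add[OF lin(1)] linear_add[OF lin(2)] linear_add[OF lin(3)]
  have emb: "linear (\<lambda>t. (t, 0) :: 'n coords)" "linear (\<lambda>u. (0, u) :: 'n coords)"
    by (rule linearI; simp)+
  note emb1 = linear_compose[OF emb(1) lin(1), unfolded o_def] linear_compose[OF emb(1) lin(2), unfolded o_def]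
      linear_compose[OF emb(1) lin(3), unfolded o_def]
  note emb2 = linear_compose[OF emb(2) lin(1), unfolded o_def] linear_compose[OF emb(2) lin(2), unfolded o_def]
      linear_compose[OF emb(2) lin(3), unfolded o_def]
  have act: "coord_act B (t, 0) = 0" "coord_act B (0, u) = (0, diag_act B u)" for B t u
    by (simp_all add: coord_act_def diag_act_def vec_eq_iff zero_prod_def)
  have TTV: "F (t, 0) (s, 0) (0, w) = 0" "F (t, 0) (0, w) (s, 0) = 0" "F (0, w) (t, 0) (s, 0) = 0" for t s w
  proof -
    show "F (t, 0) (s, 0) (0, w) = 0"
      by (rule invariant_linear_form_0[OF emb2(3)])
        (use inv[OF mat_i, of "(t, 0)" "(s, 0)" "(0, u)" for u] in \<open>simp add: act zero\<close>)
    show "F (t, 0) (0, w) (s, 0) = 0"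
      by (rule invariant_linear_form_0[OF emb2(2)])
        (use inv[OF mat_i, of "(t, 0)" "(0, u)" "(s, 0)" for u] in \<open>simp add: act zero\<close>)
    show "F (0, w) (t, 0) (s, 0) = 0"
      by (rule invariant_linear_form_0[OF emb2(1)])
        (use inv[OF mat_i, of "(0, u)" "(t, 0)" "(s, 0)" for u] in \<open>simp add: act zero\<close>)
  qed
  have VVV: "F (0, u) (0, v) (0, w) = 0" for u v w
  proof (rule invariant_trilinear_form_0)
    show "trilinear (\<lambda>u v w. F (0, u) (0, v) (0, w))"
      by (simp add: trilinear_def emb2)
    show "F (0, diag_act (mat \<i>) u) (0, v) (0, w) + F (0, u) (0, diag_act (mat \<i>) v) (0, w) +
        F (0, u) (0, v) (0, diag_act (mat \<i>) w) = 0" for u v w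
      using inv[OF mat_i, of "(0, u)" "(0, v)" "(0, w)"] by (simp add: act)
  qed
  have "\<exists>C. (\<lambda>v w. F (t, 0) (0, v) (0, w)) = pair_form C" for t
    by (rule invariant_bilinear_pair_form)
      (use inv[of _ "(t, 0)" "(0, u)" "(0, v)" for u v] in \<open>auto simp: bilinear_def emb2 act zero\<close>)
  then obtain P where P: "F (t, 0) (0, v) (0, w) = pair_form (P t) v w" for t v w by metis
  have "\<exists>C. (\<lambda>u w. F (0, u) (t, 0) (0, w)) = pair_form C" for t
    by (rule invariant_bilinear_pair_form)
      (use inv[of _ "(0, u)" "(t, 0)" "(0, v)" for u v] in \<open>auto simp: bilinear_def emb2 act zero\<close>)
  then obtain Q where Q: "F (0, u) (t, 0) (0, w) = pair_form (Q t) u w" for t u w by metis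
  have "\<exists>C. (\<lambda>u v. F (0, u) (0, v) (t, 0)) = pair_form C" for t
    by (rule invariant_bilinear_pair_form)
      (use inv[of _ "(0, u)" "(0, v)" "(t, 0)" for u v] in \<open>auto simp: bilinear_def emb2 act zero\<close>)
  then obtain R where R: "F (0, u) (0, v) (t, 0) = pair_form (R t) u v" for t u v by metis
  let ?A = "\<chi> a b c. F (axis a 1, 0) (axis b 1, 0) (axis c 1, 0)"
  let ?G = "coord_form ?A (\<chi> a. P (axis a 1)) (\<chi> a. Q (axis a 1)) (\<chi> a. R (axis a 1)) :: 'n coords \<Rightarrow> _"
  have G: "trilinear ?G" by (rule trilinear_coord_form)
  note Glin = trilinearD[OF G]
  note Gadd = linear_add[OF Glin(1)] linear_add[OF Glin(2)] linear_add[OF Glin(3)]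
  have 1: "F (t, 0) (s, 0) (r, 0) = ?G (t, 0) (s, 0) (r, 0)" for t s r
    by (subst linear_real3[OF emb1(1)], subst linear_real3[OF emb1(2)], subst linear_real3[OF emb1(3)])
      (simp add: coord_form_values sum_distrib_left mult_ac)
  have 2: "F (t, 0) (0, v) (0, w) = ?G (t, 0) (0, v) (0, w)" for t v w
    by (subst linear_real3[OF emb1(1)]) (simp add: coord_form_values P)
  have 3: "F (0, u) (s, 0) (0, w) = ?G (0, u) (s, 0) (0, w)" for s u w
    by (subst linear_real3[OF emb1(2)]) (simp add: coord_form_values Q)
  have 4: "F (0, u) (0, v) (r, 0) = ?G (0, u) (0, v) (r, 0)" for r u v
    by (subst linear_real3[OF emb1(3)]) (simp add: coord_form_values R)
  have 5: "?G (t, 0) (s, 0) (0, w) = 0" "?G (t, 0) (0, w) (s, 0) = 0" "?G (0, w) (t, 0) (s, 0) = 0"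
     "?G (0, u) (0, v) (0, w) = 0" for t s w u v
    by (simp_all add: coord_form_def pair_form_lin)
  have "F x y z = ?G x y z" for x y z
  proof -
    have d: "x = (fst x, 0) + (0, snd x)" for x :: "'n coords" by simp
    show ?thesis
      by (subst (1 2) d[of x], subst (1 2) d[of y], subst (1 2) d[of z])
        (simp only: add Gadd 2 3 4 5 TTV VVV 1[of "fst x" "fst y" "fst z"])
  qed
  then show ?thesis by blast
qed

section \<open>Symmetries of invariant forms\<close>

lemma pair_form_swap: "pair_form C u v = pair_form (cadjoint C) v (u :: (complex ^ 'n::finite) ^ 2)"
proof -
  have "inner (c *s x) y = inner (cnj c *s y) x" for c and x y :: "complex ^ 'n"
    by (subst inner_scalar_mult) (rule inner_commute)
  from this[of "C $ p $ q" for p q] show ?thesis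
    by (simp add: pair_form_def cadjoint_def sum_2)
qed

lemma coord_form_linear:
  "coord_form (A + A') (P + P') (Q + Q') (R + R') = coord_form A P Q R + coord_form A' P' Q' R'"
  "coord_form (r *\<^sub>R A) (r *\<^sub>R P) (r *\<^sub>R Q) (r *\<^sub>R R) = r *\<^sub>R coord_form A P Q R"
  by (auto simp: fun_eq_iff scaleR_fun_def coord_form_def pair_form_linear_in_matrix ring_distribs
      sum.distrib sum_distrib_left mult_ac)

lemma coord_form_minus:
  fixes x y z :: "'n::finite coords"
  shows "coord_form (- A) (- P) (- Q) (- R) x y z = - coord_form A P Q R x y z"
proof -
  have "(coord_form (- A) (- P) (- Q) (- R) :: 'n coords \<Rightarrow> _) = - coord_form A P Q R"
    using coord_form_linear(2)[of "-1" A P Q R] by simp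
  then show ?thesis by simp
qed

definition swap12 :: "'a ^ 'k ^ 'k ^ 'k \<Rightarrow> 'a ^ 'k ^ 'k ^ 'k" where
  "swap12 A = (\<chi> a b c. A $ b $ a $ c)"

definition swap23 :: "'a ^ 'k ^ 'k ^ 'k \<Rightarrow> 'a ^ 'k ^ 'k ^ 'k" where
  "swap23 A = (\<chi> a b c. A $ a $ c $ b)"

definition adjoints :: "complex ^ 2 ^ 2 ^ 3 \<Rightarrow> complex ^ 2 ^ 2 ^ 3" where
  "adjoints P = (\<chi> a. cadjoint (P $ a))"

text \<open>
  Exchanging the last two arguments exchanges the roles of \<open>Q\<close> and \<open>R\<close>, and replaces the matrices in
  \<open>P\<close>, which pair the exchanged arguments, by their adjoints.
\<close>

lemma coord_form_swap23: "coord_form A P Q R x z y = coord_form (swap23 A) (adjoints P) R Q x y z"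
proof -
  have "(\<Sum>b\<in>UNIV. \<Sum>c\<in>UNIV. A $ a $ b $ c * fst x $ a * fst z $ b * fst y $ c)
    = (\<Sum>b\<in>UNIV. \<Sum>c\<in>UNIV. A $ a $ c $ b * fst x $ a * fst y $ b * fst z $ c)" for a
    by (subst sum.swap) (simp add: mult_ac)
  then show ?thesis
    by (simp add: coord_form_def swap23_def adjoints_def pair_form_swap[of _ "snd z" "snd y"])
qed

lemma coord_form_swap12: "coord_form A P Q R y x z = coord_form (swap12 A) Q P (adjoints R) x y z"
proof -
  have "(\<Sum>a\<in>UNIV. \<Sum>b\<in>UNIV. \<Sum>c\<in>UNIV. A $ a $ b $ c * fst y $ a * fst x $ b * fst z $ c)
    = (\<Sum>a\<in>UNIV. \<Sum>b\<in>UNIV. \<Sum>c\<in>UNIV. A $ b $ a $ c * fst x $ a * fst y $ b * fst z $ c)"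
    by (subst sum.swap) (simp add: mult_ac)
  then show ?thesis
    by (simp add: coord_form_def swap12_def adjoints_def pair_form_swap[of _ "snd y" "snd x"])
qed

lemma pair_form_eqD:
  assumes "\<And>u v :: (complex ^ 'n::finite) ^ 2. pair_form C u v = pair_form D u v"
  shows "C = D"
proof -
  have "pair_form (C + (-1) *\<^sub>R D) u v = 0" for u v :: "(complex ^ 'n) ^ 2"
    unfolding pair_form_linear_in_matrix assms by simp
  then have "C + (-1) *\<^sub>R D = 0" by (rule pair_form_eq_0)
  then show ?thesis by simp
qed

text \<open>
  The coefficients can be read off from the values on basis vectors of \<open>\<real>\<^sup>3\<close> and vectors of \<open>V\<^sup>2\<close>, so
  symmetries of a form become symmetries of its coefficients.
\<close>

lemma coord_form_eq_iff:
  "(coord_form A P Q R :: 'n::finite coords \<Rightarrow> _) = coord_form A' P' Q' R' \<longleftrightarrow> A = A' \<and> P = P' \<and> Q = Q' \<and> R = R'"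
proof (rule iffI)
  assume eq: "(coord_form A P Q R :: 'n coords \<Rightarrow> _) = coord_form A' P' Q' R'"
  then have eq: "coord_form A P Q R x y z = coord_form A' P' Q' R' x y z" for x y z :: "'n coords" by simp
  have "A $ a $ b $ c = A' $ a $ b $ c" for a b c
    using eq[of "(axis a 1, 0)" "(axis b 1, 0)" "(axis c 1, 0)"] by (simp add: coord_form_values_axis)
  moreover have "P $ a = P' $ a" for a
    using eq[of "(axis a 1, 0)" "(0, u)" "(0, v)" for u v]
    by (intro pair_form_eqD[where 'n = 'n]) (simp add: coord_form_values_axis)
  moreover have "Q $ a = Q' $ a" for a
    using eq[of "(0, u)" "(axis a 1, 0)" "(0, v)" for u v]
    by (intro pair_form_eqD[where 'n = 'n]) (simp add: coord_form_values_axis)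
  moreover have "R $ a = R' $ a" for a
    using eq[of "(0, u)" "(0, v)" "(axis a 1, 0)" for u v]
    by (intro pair_form_eqD[where 'n = 'n]) (simp add: coord_form_values_axis)
  ultimately show "A = A' \<and> P = P' \<and> Q = Q' \<and> R = R'"
    by (simp add: vec_eq_iff)
qed simp

lemma coord_form_skew23_iff:
  "(\<forall>x y z :: 'n::finite coords. coord_form A P Q R x z y = - coord_form A P Q R x y z) \<longleftrightarrow>
   swap23 A = - A \<and> adjoints P = - P \<and> R = - Q"
proof -
  have "(\<forall>x y z :: 'n coords. coord_form A P Q R x z y = - coord_form A P Q R x y z) \<longleftrightarrow>
    (coord_form (swap23 A) (adjoints P) R Q :: 'n coords \<Rightarrow> _) = coord_form (- A) (- P) (- Q) (- R)"
    by (simp add: fun_eq_iff coord_form_minus coord_form_swap23[of A P Q R])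
  then show ?thesis unfolding coord_form_eq_iff by auto
qed

lemma coord_form_skew12_iff:
  "(\<forall>x y z :: 'n::finite coords. coord_form A P Q R y x z = - coord_form A P Q R x y z) \<longleftrightarrow>
   swap12 A = - A \<and> adjoints R = - R \<and> Q = - P"
proof -
  have "(\<forall>x y z :: 'n coords. coord_form A P Q R y x z = - coord_form A P Q R x y z) \<longleftrightarrow>
    (coord_form (swap12 A) Q P (adjoints R) :: 'n coords \<Rightarrow> _) = coord_form (- A) (- P) (- Q) (- R)"
    by (simp add: fun_eq_iff coord_form_minus coord_form_swap12[of A P Q R])
  then show ?thesis unfolding coord_form_eq_iff by auto
qed

text \<open>
  In dimension three the skew matrices are those of the forms \<open>(s, r) \<mapsto> v \<bullet> (s \<times> r)\<close>. Hence arrays that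
  are skew in the last two indices are parametrized by matrices, whose rows are the vectors \<open>v\<close>; the
  scalar matrices give the multiples of the determinant.
\<close>

definition cross_tensor :: "real ^ 3 ^ 3 \<Rightarrow> real ^ 3 ^ 3 ^ 3" where
  "cross_tensor M = (\<chi> a b c. M $ a \<bullet> cross3 (axis b 1) (axis c 1))"

lemma cross_tensor_linear:
  "cross_tensor (M + N) = cross_tensor M + cross_tensor N" "cross_tensor (r *\<^sub>R M) = r *\<^sub>R cross_tensor M"
  by (simp_all add: cross_tensor_def vec_eq_iff inner_add_left)

lemma cross_tensor_nth:
  "cross_tensor M $ a $ 1 $ 1 = 0" "cross_tensor M $ a $ 2 $ 2 = 0" "cross_tensor M $ a $ 3 $ 3 = 0"
  "cross_tensor M $ a $ 1 $ 2 = M $ a $ 3" "cross_tensor M $ a $ 2 $ 1 = - M $ a $ 3"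
  "cross_tensor M $ a $ 2 $ 3 = M $ a $ 1" "cross_tensor M $ a $ 3 $ 2 = - M $ a $ 1"
  "cross_tensor M $ a $ 3 $ 1 = M $ a $ 2" "cross_tensor M $ a $ 1 $ 3 = - M $ a $ 2"
  by (simp_all add: cross_tensor_def cross3_def axis_def inner_vec_def sum_3)

lemma cross_tensor_inj: "cross_tensor M = cross_tensor N \<Longrightarrow> M = N"
  unfolding vec_eq_iff[of M N] vec_eq_iff[of "M $ _" "N $ _"] forall_3
  by (metis cross_tensor_nth(4,6,8))

lemma swap23_skew_iff: "swap23 A = - A \<longleftrightarrow> (\<exists>M. A = cross_tensor M)"
proof
  assume "swap23 A = - A"
  then have eq: "swap23 A $ a $ b $ c = (- A) $ a $ b $ c" for a b c by (simp only:)
  have skew: "A $ a $ c $ b = - A $ a $ b $ c" for a b c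
    using eq[of a b c] by (simp add: swap23_def)
  have "A $ a $ b $ b = 0" for a b using skew[of a b b] by simp
  then have "A = cross_tensor (\<chi> a. vector [A $ a $ 2 $ 3, A $ a $ 3 $ 1, A $ a $ 1 $ 2])"
    by (simp add: vec_eq_iff forall_3 cross_tensor_nth skew[of _ 2 1] skew[of _ 3 2] skew[of _ 1 3])
  then show "\<exists>M. A = cross_tensor M" ..
qed (auto simp: swap23_def vec_eq_iff forall_3 cross_tensor_nth)

text \<open>
  Skewness in the first two indices compares \<open>A $ 1 $ 2 $ 3\<close>, \<open>A $ 2 $ 3 $ 1\<close> and \<open>A $ 3 $ 1 $ 2\<close>, which are
  the diagonal entries of \<open>M\<close>, and makes the entries with a repeated index, which are the
  off-diagonal entries of \<open>M\<close>, vanish.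
\<close>

lemma swap12_swap23_skew_iff: "swap12 A = - A \<and> swap23 A = - A \<longleftrightarrow> (\<exists>k. A = cross_tensor (mat k))"
proof
  assume A: "swap12 A = - A \<and> swap23 A = - A"
  then obtain M where M: "A = cross_tensor M" using swap23_skew_iff[of A] by auto
  have skew: "A $ b $ a $ c = - A $ a $ b $ c" for a b c
  proof -
    have "swap12 A $ a $ b $ c = (- A) $ a $ b $ c" using A by (simp only:)
    then show ?thesis by (simp add: swap12_def)
  qed
  have "M = mat (M $ 1 $ 1)"
    using skew[of 1 2 3] skew[of 1 1 2] skew[of 1 1 3] skew[of 2 2 1] skew[of 2 2 3] skew[of 3 3 1] skew[of 3 3 2]
      skew[of 2 3 1]
    by (simp add: M vec_eq_iff forall_3 mat_def cross_tensor_nth)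
  then show "\<exists>k. A = cross_tensor (mat k)" using M by metis
next
  assume "\<exists>k. A = cross_tensor (mat k)"
  then show "swap12 A = - A \<and> swap23 A = - A"
    by (auto simp: swap12_def swap23_def vec_eq_iff forall_3 cross_tensor_nth mat_def)
qed

definition skew_hermitian :: "real \<times> real \<times> complex \<Rightarrow> complex ^ 2 ^ 2" where
  "skew_hermitian k = vector [vector [\<i> * of_real (fst k), snd (snd k)],
     vector [- cnj (snd (snd k)), \<i> * of_real (fst (snd k))]]"

definition skew_hermitians :: "(real \<times> real \<times> complex) ^ 3 \<Rightarrow> complex ^ 2 ^ 2 ^ 3" where
  "skew_hermitians K = (\<chi> a. skew_hermitian (K $ a))"

lemma skew_hermitians_linear:
  "skew_hermitians (K + L) = skew_hermitians K + skew_hermitians L"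
  "skew_hermitians (r *\<^sub>R K) = r *\<^sub>R skew_hermitians K"
  by (simp_all add: skew_hermitians_def skew_hermitian_def vec_eq_iff forall_2 algebra_simps
      scaleR_conv_of_real[where 'a = complex])

lemma skew_hermitians_inj: "skew_hermitians K = skew_hermitians L \<Longrightarrow> K = L"
  by (auto simp: skew_hermitians_def skew_hermitian_def vec_eq_iff forall_2 prod_eq_iff)

lemma adjoints_skew_iff: "adjoints P = - P \<longleftrightarrow> (\<exists>K. P = skew_hermitians K)"
proof
  assume "adjoints P = - P"
  then have eq: "adjoints P $ a $ p $ q = (- P) $ a $ p $ q" for a p q by (simp only:)
  have skew: "cnj (P $ a $ q $ p) = - P $ a $ p $ q" for a p q
    using eq[of a p q] by (simp add: adjoints_def cadjoint_def)
  have "P $ a $ p $ p = \<i> * of_real (Im (P $ a $ p $ p))" for a p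
    using skew[of a p p] by (simp add: complex_eq_iff)
  then have "P = skew_hermitians (\<chi> a. (Im (P $ a $ 1 $ 1), Im (P $ a $ 2 $ 2), P $ a $ 1 $ 2))"
    using skew[of _ 1 2] by (simp add: vec_eq_iff forall_2 skew_hermitians_def skew_hermitian_def)
  then show "\<exists>K. P = skew_hermitians K" ..
qed (auto simp: adjoints_def cadjoint_def vec_eq_iff forall_2 skew_hermitians_def skew_hermitian_def)

section \<open>The isotropy representation in coordinates\<close>

text \<open>
  The second copy of \<open>V\<close> is \<open>vcnj z\<^sub>2\<close> rather than \<open>z\<^sub>2\<close>, because \<open>z\<^sub>2\<close> transforms by the dual
  representation \<open>- B\<^sup>t\<close>, which is the complex conjugate of the standard one.
\<close>

definition from_coords :: "'n::finite coords \<Rightarrow> 'n m_space" where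
  "from_coords x = Abs_m_space (m_mat (fst x $ 1) (snd x $ 1) (vcnj (snd x $ 2)) (Complex (fst x $ 2) (fst x $ 3)))"

definition to_coords :: "'n::finite m_space \<Rightarrow> 'n coords" where
  "to_coords = inv from_coords"

lemma Rep_from_coords:
  "Rep_m_space (from_coords x) = m_mat (fst x $ 1) (snd x $ 1) (vcnj (snd x $ 2)) (Complex (fst x $ 2) (fst x $ 3))"
  unfolding from_coords_def by (rule Abs_m_space_inverse) (auto simp: reductive_complement_def)

lemma m_mat_eq_iff: "m_mat \<alpha> z1 z2 w = m_mat \<beta> y1 y2 v \<longleftrightarrow> \<alpha> = \<beta> \<and> z1 = y1 \<and> z2 = y2 \<and> w = v"
proof
  assume "m_mat \<alpha> z1 z2 w = m_mat \<beta> y1 y2 v"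
  then have eq: "m_mat \<alpha> z1 z2 w $ i $ j = m_mat \<beta> y1 y2 v $ i $ j" for i j by simp
  show "\<alpha> = \<beta> \<and> z1 = y1 \<and> z2 = y2 \<and> w = v"
    using eq[of "Inl ()" "Inl ()"] eq[of "Inl ()" "Inr (Inr ())"] eq[of "Inl ()" "Inr (Inl k)" for k]
      eq[of "Inr (Inl k)" "Inr (Inr ())" for k]
    by (simp add: m_mat_def block_mat_def vec_eq_iff)
qed simp

lemma linear_from_coords: "linear (from_coords :: 'n::finite coords \<Rightarrow> _)"
proof (rule linearI)
  have cnj: "vcnj (y + z) = vcnj y + vcnj z" "vcnj (r *\<^sub>R y) = r *\<^sub>R vcnj y" for y z :: "complex ^ 'n" and r
    by (simp_all add: vcnj_def vec_eq_iff)
  fix x y :: "'n coords" and r :: real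
  show "from_coords (x + y) = from_coords x + from_coords y"
    by (simp add: Rep_from_coords plus_m_space.rep_eq m_mat_add cnj m_mat_eq_iff complex_eq_iff
        flip: Rep_m_space_inject)
  show "from_coords (r *\<^sub>R x) = r *\<^sub>R from_coords x"
    by (simp add: Rep_from_coords scaleR_m_space.rep_eq m_mat_scaleR cnj m_mat_eq_iff complex_eq_iff
        flip: Rep_m_space_inject)
qed

lemma bij_from_coords: "bij (from_coords :: 'n::finite coords \<Rightarrow> _)"
proof (rule bijI)
  show "inj (from_coords :: 'n coords \<Rightarrow> _)"
  proof (rule injI)
    fix x y :: "'n coords" assume "from_coords x = from_coords y"
    then have "Rep_m_space (from_coords x) = Rep_m_space (from_coords y)" by simp
    then have "fst x $ 1 = fst y $ 1 \<and> fst x $ 2 = fst y $ 2 \<and> fst x $ 3 = fst y $ 3 \<and> snd x $ 1 = snd y $ 1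
        \<and> vcnj (snd x $ 2) = vcnj (snd y $ 2)"
      unfolding Rep_from_coords m_mat_eq_iff by simp
    moreover from this have "snd x $ 2 = snd y $ 2" by (metis vcnj_simps(3))
    ultimately show "x = y"
      by (simp add: prod_eq_iff vec_eq_iff[of "fst x"] vec_eq_iff[of "snd x"] forall_3 forall_2)
  qed
  show "surj (from_coords :: 'n coords \<Rightarrow> _)"
  proof -
    have "\<exists>x. X = from_coords x" for X :: "'n m_space"
    proof -
      obtain \<alpha> z1 z2 w where X: "Rep_m_space X = m_mat \<alpha> z1 z2 w"
        using Rep_m_space[of X] by (auto simp: reductive_complement_def)
      have "Rep_m_space X = Rep_m_space (from_coords (vector [\<alpha>, Re w, Im w], vector [z1, vcnj z2]))"
        by (simp add: X Rep_from_coords vcnj_simps)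
      then show ?thesis by (auto simp: Rep_m_space_inject)
    qed
    then show ?thesis by (auto simp: surj_def)
  qed
qed

lemma to_from_coords [simp]: "to_coords (from_coords x) = x"
  by (simp add: to_coords_def bij_is_inj[OF bij_from_coords])

lemma from_to_coords [simp]: "from_coords (to_coords X) = X"
  by (simp add: to_coords_def bij_is_surj[OF bij_from_coords] surj_f_inv_f)

lemma linear_to_coords: "linear (to_coords :: 'n::finite m_space \<Rightarrow> _)"
proof (rule linearI)
  fix X Y :: "'n m_space" and r :: real
  have "X + Y = from_coords (to_coords X + to_coords Y)" "r *\<^sub>R X = from_coords (r *\<^sub>R to_coords X)"
    by (simp_all add: linear_add[OF linear_from_coords] linear_cmul[OF linear_from_coords])
  then show "to_coords (X + Y) = to_coords X + to_coords Y" "to_coords (r *\<^sub>R X) = r *\<^sub>R to_coords X"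
    by simp_all
qed

lemma u_trace_shift:
  fixes B :: "complex ^ 'n::finite ^ 'n"
  assumes "B \<in> \<uu>"
  shows "B + mat (of_real r * trace B) \<in> \<uu>"
  using u_entry[OF assms] trace_u[OF assms]
  by (auto simp: unitary_algebra_def cadjoint_def mat_def vec_eq_iff)

lemma m_act_from_coords:
  fixes B :: "complex ^ 'n::finite ^ 'n"
  assumes B: "B \<in> \<uu>"
  shows "m_act (h_mat B) (from_coords x) = from_coords (coord_act (B + mat (trace B / 2)) x)"
proof -
  have h: "h_mat B \<in> \<hh>" using B by (auto simp: isotropy_algebra_def)
  have "vcnj (B *v y + (trace B / 2) *s y) = - (transpose B *v vcnj y) - (trace B / 2) *s vcnj y" for y
    by (simp add: vec_eq_iff vcnj_def matrix_vector_mult_def transpose_def u_entry[OF B] trace_u[OF B] sum_negf)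
  then show ?thesis
    unfolding Rep_m_space_inject[symmetric] Rep_m_act[OF h]
    by (simp add: Rep_from_coords bracket_h_mat_m_mat[OF B] m_mat_eq_iff coord_act_def diag_act_def
        matrix_vector_mult_add_rdistrib mat_vector_mult complex_eq_iff)
qed

lemma isotropy_acts_as_u:
  fixes X :: "'n::finite block_matrix"
  assumes "X \<in> \<hh>"
  shows "\<exists>C\<in>\<uu>. \<forall>x. m_act X (from_coords x) = from_coords (coord_act C x)"
proof -
  obtain B where B: "B \<in> \<uu>" and X: "X = h_mat B" using assms by (auto simp: isotropy_algebra_def)
  show ?thesis
    using m_act_from_coords[OF B] u_trace_shift[OF B, of "1/2"] unfolding X by (intro bexI[of _ "B + mat (trace B / 2)"]) auto
qed

text \<open>
  The shift \<open>B \<mapsto> B + (tr B / 2) I\<close> multiplies the trace by \<open>(n + 2) / 2\<close>. So \<open>B = C - (tr C / (n + 2)) I\<close>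
  is the solution for a given \<open>C\<close>.
\<close>

lemma u_acts_through_isotropy:
  fixes C :: "complex ^ 'n::finite ^ 'n"
  assumes C: "C \<in> \<uu>"
  shows "\<exists>X\<in>\<hh>. \<forall>x. m_act X (from_coords x) = from_coords (coord_act C x)"
proof -
  let ?N = "of_nat CARD('n) :: complex"
  define B where "B = C + mat (of_real (- 1 / (real CARD('n) + 2)) * trace C)"
  have N: "?N + 2 \<noteq> 0"
    by (metis of_nat_add of_nat_eq_0_iff of_nat_numeral add_eq_0_iff_both_eq_0 zero_neq_numeral)
  have "trace B = trace C - trace C / (?N + 2) * ?N"
    by (simp add: B_def trace_def mat_def sum.distrib sum_subtractf)
  also have "\<dots> = 2 * (trace C / (?N + 2))"
    using N by (simp add: field_simps)
  finally have tr: "trace B = 2 * (trace C / (?N + 2))" .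
  have half: "trace B / 2 = trace C / (?N + 2)"
    by (subst tr) (rule nonzero_mult_div_cancel_left, simp)
  have "B + mat (trace B / 2) = C"
    unfolding half by (simp add: B_def vec_eq_iff mat_def)
  moreover have "B \<in> \<uu>" unfolding B_def by (rule u_trace_shift[OF C])
  ultimately show ?thesis
    using m_act_from_coords[of B] by (intro bexI[of _ "h_mat B"]) (auto simp: isotropy_algebra_def)
qed

definition m_inner :: "'n::finite m_space \<Rightarrow> 'n m_space \<Rightarrow> real" where
  "m_inner x y = to_coords x \<bullet> to_coords y"

lemma inner_coord_act:
  fixes C :: "complex ^ 'n::finite ^ 'n"
  assumes "C \<in> \<uu>"
  shows "coord_act C x \<bullet> y = - (x \<bullet> coord_act C y)"
proof -
  have "u \<bullet> v = (\<Sum>p\<in>UNIV. u $ p \<bullet> v $ p)" for u v :: "(complex ^ 'n) ^ 2"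
    by (rule inner_vec_def)
  then show ?thesis
    by (simp add: coord_act_def diag_act_def inner_prod_def inner_u[OF assms] sum_negf)
qed

text \<open>
  The Euclidean structure of the coordinates is invariant, since \<open>\<uu>(n)\<close> acts by skew operators on each
  copy of \<open>V\<close>.
\<close>

lemma invariant_inner_product_m:
  "invariant_inner_product (\<hh> :: 'n::finite block_matrix set) m_act m_inner (from_coords ` Basis)"
proof (rule invariant_inner_product.intro)
  show "linear (m_act X)" if "X \<in> \<hh>" for X :: "'n block_matrix"
    using that by (rule linear_m_act)
  show "bilinear (m_inner :: 'n m_space \<Rightarrow> _)"
    unfolding bilinear_def linear_iff
    by (simp add: m_inner_def linear_add[OF linear_to_coords] linear_cmul[OF linear_to_coords] inner_add_left inner_add_right)
  show "m_inner x y = m_inner y x" for x y :: "'n m_space"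
    by (simp add: m_inner_def inner_commute)
  show "finite (from_coords ` Basis :: 'n m_space set)" by simp
  show "(\<Sum>e\<in>from_coords ` Basis. m_inner x e *\<^sub>R e) = x" for x :: "'n m_space"
  proof -
    have "(\<Sum>e\<in>from_coords ` Basis. m_inner x e *\<^sub>R e) = (\<Sum>b\<in>Basis. (to_coords x \<bullet> b) *\<^sub>R from_coords b)"
      by (subst sum.reindex) (auto simp: m_inner_def intro: inj_on_subset[OF bij_is_inj[OF bij_from_coords]])
    also have "\<dots> = from_coords (\<Sum>b\<in>Basis. (to_coords x \<bullet> b) *\<^sub>R b)"
      by (simp only: linear_sum[OF linear_from_coords] linear_cmul[OF linear_from_coords])
    finally show ?thesis by (simp add: euclidean_representation)
  qed
  show "m_inner (m_act X x) y = - m_inner x (m_act X y)" if X: "X \<in> \<hh>" for X and x y :: "'n m_space"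
  proof -
    obtain C where C: "C \<in> \<uu>" and "\<And>x. m_act X (from_coords x) = from_coords (coord_act C x)"
      using isotropy_acts_as_u[OF X] by blast
    then have "to_coords (m_act X x) = coord_act C (to_coords x)" for x
      by (metis from_to_coords to_from_coords)
    then show ?thesis by (simp add: m_inner_def inner_coord_act[OF C])
  qed
qed

section \<open>The spaces of invariant forms and their dimensions\<close>

definition m_form :: "real ^ 3 ^ 3 ^ 3 \<Rightarrow> complex ^ 2 ^ 2 ^ 3 \<Rightarrow> complex ^ 2 ^ 2 ^ 3 \<Rightarrow> complex ^ 2 ^ 2 ^ 3 \<Rightarrow>
    'n::finite m_space \<Rightarrow> 'n m_space \<Rightarrow> 'n m_space \<Rightarrow> real" where
  "m_form A P Q R x y z = coord_form A P Q R (to_coords x) (to_coords y) (to_coords z)"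

lemma m_form_linear:
  "m_form (A + A') (P + P') (Q + Q') (R + R') = m_form A P Q R + m_form A' P' Q' R'"
  "m_form (r *\<^sub>R A) (r *\<^sub>R P) (r *\<^sub>R Q) (r *\<^sub>R R) = r *\<^sub>R m_form A P Q R"
  by (simp_all add: fun_eq_iff m_form_def coord_form_linear scaleR_fun_def)

lemma m_form_eq_iff:
  "(m_form A P Q R :: 'n::finite m_space \<Rightarrow> _) = m_form A' P' Q' R' \<longleftrightarrow> A = A' \<and> P = P' \<and> Q = Q' \<and> R = R'"
proof -
  have "(m_form A P Q R :: 'n m_space \<Rightarrow> _) = m_form A' P' Q' R' \<longleftrightarrow>
    (coord_form A P Q R :: 'n coords \<Rightarrow> _) = coord_form A' P' Q' R'"
    unfolding fun_eq_iff m_form_def by (metis to_from_coords)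
  then show ?thesis by (simp add: coord_form_eq_iff)
qed

lemma invariant_forms_m:
  "invariant_forms \<hh> m_act = {m_form A P Q R :: 'n::finite m_space \<Rightarrow> _ | A P Q R. True}"
proof (intro equalityI subsetI)
  fix F :: "'n m_space \<Rightarrow> 'n m_space \<Rightarrow> 'n m_space \<Rightarrow> real"
  assume "F \<in> invariant_forms \<hh> m_act"
  then have F: "trilinear F"
    and inv: "\<And>X x y z. X \<in> \<hh> \<Longrightarrow> F (m_act X x) y z + F x (m_act X y) z + F x y (m_act X z) = 0"
    by (auto simp: invariant_forms_def)
  let ?G = "\<lambda>x y z. F (from_coords x) (from_coords y) (from_coords z)"
  note lin = trilinearD[OF F]
  have "trilinear ?G"
    unfolding trilinear_def
    using linear_compose[OF linear_from_coords lin(1)] linear_compose[OF linear_from_coords lin(2)]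
      linear_compose[OF linear_from_coords lin(3)] by (simp add: o_def)
  moreover have "?G (coord_act C x) y z + ?G x (coord_act C y) z + ?G x y (coord_act C z) = 0"
    if "C \<in> \<uu>" for C x y z
    using u_acts_through_isotropy[OF that] inv by metis
  ultimately obtain A P Q R where G: "?G = coord_form A P Q R"
    using invariant_is_coord_form[of ?G] by blast
  have "F x y z = m_form A P Q R x y z" for x y z
    unfolding m_form_def G[symmetric] by simp
  then have "F = m_form A P Q R" by blast
  then show "F \<in> {m_form A P Q R | A P Q R. True}" by blast
next
  fix F :: "'n m_space \<Rightarrow> 'n m_space \<Rightarrow> 'n m_space \<Rightarrow> real"
  assume "F \<in> {m_form A P Q R | A P Q R. True}"
  then obtain A P Q R where F: "F = m_form A P Q R" by blast
  have "trilinear F"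
    unfolding F trilinear_def m_form_def
    using trilinearD[OF trilinear_coord_form, THEN linear_compose[OF linear_to_coords], unfolded o_def] by blast
  moreover have "F (m_act X x) y z + F x (m_act X y) z + F x y (m_act X z) = 0" if X: "X \<in> \<hh>" for X x y z
  proof -
    obtain C where C: "C \<in> \<uu>" and "\<And>x. m_act X (from_coords x) = from_coords (coord_act C x)"
      using isotropy_acts_as_u[OF X] by blast
    then have "to_coords (m_act X x) = coord_act C (to_coords x)" for x
      by (metis from_to_coords to_from_coords)
    then show ?thesis by (simp add: F m_form_def coord_form_invariant[OF C])
  qed
  ultimately show "F \<in> invariant_forms \<hh> m_act" by (simp add: invariant_forms_def)
qed

lemma m_form_skew23_iff:
  "(\<forall>x y z :: 'n::finite m_space. m_form A P Q R x z y = - m_form A P Q R x y z) \<longleftrightarrow>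
   swap23 A = - A \<and> adjoints P = - P \<and> R = - Q"
  unfolding coord_form_skew23_iff[where 'n = 'n, symmetric] m_form_def by (metis to_from_coords)

lemma m_form_skew12_iff:
  "(\<forall>x y z :: 'n::finite m_space. m_form A P Q R y x z = - m_form A P Q R x y z) \<longleftrightarrow>
   swap12 A = - A \<and> adjoints R = - R \<and> Q = - P"
  unfolding coord_form_skew12_iff[where 'n = 'n, symmetric] m_form_def by (metis to_from_coords)

text \<open>
  In each of the three counts the coefficients form the image of an explicit Euclidean space under an
  injective linear map, so the dimension is that of the space of parameters.
\<close>

lemma dim_invariant_forms:
  "dim (invariant_forms \<hh> m_act :: ('n::finite m_space \<Rightarrow> _) set) = 99"
proof -
  let ?T = "\<lambda>(A, P, Q, R). m_form A P Q R :: 'n m_space \<Rightarrow> _"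
  have "linear ?T" by (rule linearI) (auto simp: m_form_linear)
  moreover have "inj ?T" by (rule injI) (auto simp: m_form_eq_iff)
  moreover have "range ?T = invariant_forms \<hh> m_act"
    unfolding invariant_forms_m by (auto simp: image_iff) blast+
  ultimately show ?thesis using dim_range_inj[of ?T] by simp
qed

lemma dim_skew_invariant_forms:
  "dim {F \<in> invariant_forms \<hh> m_act. \<forall>x y z :: 'n::finite m_space. F x z y = - F x y z} = 45"
proof -
  let ?T = "\<lambda>(M, K, Q). m_form (cross_tensor M) (skew_hermitians K) Q (- Q) :: 'n m_space \<Rightarrow> _"
  have "linear ?T"
    by (rule linearI) (auto simp: cross_tensor_linear skew_hermitians_linear
        simp flip: m_form_linear)
  moreover have "inj ?T"
    by (rule injI) (auto simp: m_form_eq_iff dest: cross_tensor_inj skew_hermitians_inj)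
  moreover have "range ?T = {F \<in> invariant_forms \<hh> m_act. \<forall>x y z. F x z y = - F x y z}" (is "_ = ?S")
  proof -
    have "?S = {m_form A P Q R | A P Q R. swap23 A = - A \<and> adjoints P = - P \<and> R = - Q}"
      unfolding invariant_forms_m using m_form_skew23_iff[where 'n = 'n] by blast
    then show ?thesis
      unfolding swap23_skew_iff adjoints_skew_iff by (auto simp: image_iff) blast+
  qed
  ultimately show ?thesis using dim_range_inj[of ?T] by simp
qed

lemma dim_alternating_invariant_forms:
  "dim {F \<in> invariant_forms \<hh> m_act. \<forall>x y z :: 'n::finite m_space. F x z y = - F x y z \<and> F y x z = - F x y z} = 13"
proof -
  let ?T = "\<lambda>(k, K). m_form (cross_tensor (mat k)) (skew_hermitians K) (- skew_hermitians K) (skew_hermitians K)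
    :: 'n m_space \<Rightarrow> _"
  have mat: "mat (k + l) = mat k + (mat l :: real ^ 3 ^ 3)" "mat (r * k) = r *\<^sub>R (mat k :: real ^ 3 ^ 3)" for k l r
    by (simp_all add: vec_eq_iff mat_def)
  have mat_inj: "mat k = (mat l :: real ^ 3 ^ 3) \<Longrightarrow> k = l" for k l
    by (simp add: vec_eq_iff mat_def) metis
  have "linear ?T"
    by (rule linearI) (auto simp: cross_tensor_linear skew_hermitians_linear mat
        simp flip: m_form_linear)
  moreover have "inj ?T"
    by (rule injI) (auto simp: m_form_eq_iff dest!: cross_tensor_inj skew_hermitians_inj mat_inj)
  moreover have "range ?T = {F \<in> invariant_forms \<hh> m_act. \<forall>x y z. F x z y = - F x y z \<and> F y x z = - F x y z}" (is "_ = ?S")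
  proof -
    have "?S = {m_form A P Q R | A P Q R. (swap12 A = - A \<and> swap23 A = - A) \<and> adjoints P = - P \<and> Q = - P \<and> R = P}"
    proof -
      have "(\<forall>x y z :: 'n m_space. m_form A P Q R x z y = - m_form A P Q R x y z \<and> m_form A P Q R y x z = - m_form A P Q R x y z)
        \<longleftrightarrow> (swap12 A = - A \<and> swap23 A = - A) \<and> adjoints P = - P \<and> Q = - P \<and> R = P" for A P Q R
        unfolding all_conj_distrib m_form_skew23_iff m_form_skew12_iff by auto
      then show ?thesis unfolding invariant_forms_m by blast
    qed
    then show ?thesis
      unfolding swap12_swap23_skew_iff adjoints_skew_iff by (auto simp: image_iff)
  qed
  ultimately show ?thesis using dim_range_inj[of ?T] by simp
qed

theorem lemma4p13:
  fixes m :: nat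
  assumes "m \<ge> 3" and "CARD('n::finite) = m - 2"
  shows "dim (Lie_Hom \<hh> (tensor_act m_act m_act) m_act
               :: (('n m_space, 'n m_space) tensor \<Rightarrow> 'n m_space) set) = 99 \<and>
         dim (Lie_Hom \<hh> m_act (ext_act m_act)
               :: ('n m_space \<Rightarrow> ('n m_space, 2) ext_power) set) = 45 \<and>
         dim (Lie_Hom \<hh> (ext_act m_act) trivial_act
               :: (('n m_space, 3) ext_power \<Rightarrow> real) set) = 13"
  unfolding invariant_inner_product.dim_Hom_tensor[OF invariant_inner_product_m] invariant_inner_product.dim_Hom_ext2[OF invariant_inner_product_m] invariant_inner_product.dim_Hom_ext3[OF invariant_inner_product_m] dim_invariant_forms dim_skew_invariant_forms
    dim_alternating_invariant_forms by simp

end
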